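(* Let $L$ be a finite Lie ring, and consider the multiplicative group $\mathbb{C}^*$ as a trivial $L$-module. Then the Schur multiplier $M(L)=H_2(L,\mathbb{Z})$ of $L$ satisfies $M(L)\cong H^2(L,\mathbb{C}^* )$ as abelian groups.
   Context: A Lie ring is an additive abelian group with a biadditive bracket $[\cdot,\cdot]$ satisfying $[x,x]=0$ and the Jacobi identity (i.e. a Lie algebra over $\mathbb{Z}$). $[L,L]=L^2$ is the Lie subring generated by all commutators. The Schur multiplier of a Lie ring $L$ is $M(L)=H_2(L,\mathbb{Z})$, the second integral homology of $L$ in the category of Lie rings. Concretely: let $F_\bullet\to L$ be the simplicial resolution of $L$ by free Lie rings coming from the comonad of the free/forgetful adjunction between Lie rings and sets; then $H_{n}(L,\mathbb{Z})=\pi_{n-1}(F_\bullet/F_\bullet^2)$ for $n\ge 1$, where $F_\bullet/F_\bullet^2$ is the degreewise abelianization (so $H_2(L,\mathbb{Z})$ is the first left derived functor of the abelianization functor $L\mapsto L/L^2$). For a Lie ring $L$ and an abelian group $A$ (trivial $L$-module, written additively), $Z^2(L,A)$ is the abelian group (pointwise addition) of all pairs $(f,g)$ of functions $f,g:L\times L\to A$ such that for all $x,y,z\in L$: (1) $f(x+y,z)=f(x,z)+f(y,z)+g([x,z],[y,z])$ and $f(x,y+z)=f(x,y)+f(x,z)+g([x,y],[x,z])$; (2) $f(x,x)=0$; (3) $f(x,[y,z])+f(z,[x,y])+f(y,[z,x])=-g([x,[y,z]],[z,[x,y]])-g(-[y,[z,x]],[y,[z,x]])$; (4) $g(x+y,z)+g(x,y)=g(x,y+z)+g(y,z)$;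 (5) $g(x,y)=g(y,x)$. $B^2(L,A)$ is the subgroup of pairs $(f,g)$ of the form $f(x,y)=-t([x,y])$, $g(x,y)=t(x)+t(y)-t(x+y)$ for some map $t:L\to A$ with $t(0)=0$. $H^2(L,A)=Z^2(L,A)/B^2(L,A)$. *)

theory Defs
  imports Complex_Main "HOL-Algebra.Coset"
begin

class lie_ring = ab_group_add +
  fixes bracket :: "'a \<Rightarrow> 'a \<Rightarrow> 'a"
  assumes bracket_add_left: "bracket (x + y) z = bracket x z + bracket y z"
    and bracket_add_right: "bracket x (y + z) = bracket x y + bracket x z"
    and bracket_self: "bracket x x = 0"
    and jacobi: "bracket x (bracket y z) + bracket y (bracket z x) + bracket z (bracket x y) = 0"

definition lie_hom :: "('a::lie_ring \<Rightarrow> 'b::lie_ring) \<Rightarrow> bool" where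
  "lie_hom h \<longleftrightarrow> (\<forall>x y. h (x + y) = h x + h y) \<and> (\<forall>x y. h (bracket x y) = bracket (h x) (h y))"

lemma lie_hom_zero: "lie_hom h \<Longrightarrow> h 0 = 0"
  unfolding lie_hom_def by (metis add_cancel_right_right)

lemma lie_hom_minus: "lie_hom h \<Longrightarrow> h (- x) = - h x"
  using lie_hom_zero[of h] unfolding lie_hom_def by (metis add.right_inverse add_eq_0_iff)

lemma lie_hom_diff: "lie_hom h \<Longrightarrow> h (x - y) = h x - h y"
  using lie_hom_minus[of h y] unfolding lie_hom_def by (metis diff_conv_add_uminus)

inductive_set lie_subring_gen :: "'a::lie_ring set \<Rightarrow> 'a set" for S where
  lie_subring_gen_base: "s \<in> S \<Longrightarrow> s \<in> lie_subring_gen S"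
| lie_subring_gen_zero: "0 \<in> lie_subring_gen S"
| lie_subring_gen_add: "\<lbrakk>a \<in> lie_subring_gen S; b \<in> lie_subring_gen S\<rbrakk> \<Longrightarrow> a + b \<in> lie_subring_gen S"
| lie_subring_gen_uminus: "a \<in> lie_subring_gen S \<Longrightarrow> - a \<in> lie_subring_gen S"
| lie_subring_gen_bracket: "\<lbrakk>a \<in> lie_subring_gen S; b \<in> lie_subring_gen S\<rbrakk> \<Longrightarrow> bracket a b \<in> lie_subring_gen S"

definition lie_square :: "'a::lie_ring set" where
  "lie_square = lie_subring_gen {bracket x y | x y. True}"

lemma lie_square_zero: "0 \<in> lie_square"
  and lie_square_add: "a \<in> lie_square \<Longrightarrow> b \<in> lie_square \<Longrightarrow> a + b \<in> lie_square"
  and lie_square_uminus: "a \<in> lie_square \<Longrightarrow> - a \<in> lie_square"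
  and lie_square_bracket: "bracket x y \<in> lie_square"
  unfolding lie_square_def by (auto intro: lie_subring_gen.intros)

lemma lie_hom_lie_square:
  assumes "lie_hom h" "a \<in> lie_square"
  shows "h a \<in> lie_square"
  using assms(2)[unfolded lie_square_def]
proof induction
  case (lie_subring_gen_base s)
  then show ?case using assms(1) by (auto simp: lie_hom_def lie_square_bracket)
next
  case (lie_subring_gen_bracket a b)
  then show ?case using assms(1) by (simp add: lie_hom_def lie_square_bracket)
qed (use assms(1) in \<open>simp_all add: lie_hom_zero lie_hom_minus lie_square_zero lie_square_uminus\<close>,
     simp add: lie_hom_def lie_square_add)

quotient_type (overloaded) 'a abelianization = "'a::lie_ring" / "\<lambda>x y. x - y \<in> lie_square"
  morphisms rep_abelianization ab_class
proof (rule equivpI)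
  show "reflp (\<lambda>x y::'a. x - y \<in> lie_square)"
    by (simp add: reflp_def lie_square_zero)
  show "symp (\<lambda>x y::'a. x - y \<in> lie_square)"
  proof (rule sympI)
    fix x y :: 'a
    assume "x - y \<in> lie_square"
    then show "y - x \<in> lie_square" using lie_square_uminus[of "x - y"] by simp
  qed
  show "transp (\<lambda>x y::'a. x - y \<in> lie_square)"
  proof (rule transpI)
    fix x y z :: 'a
    assume "x - y \<in> lie_square" "y - z \<in> lie_square"
    then have "(x - y) + (y - z) \<in> lie_square" by (rule lie_square_add)
    then show "x - z \<in> lie_square" by simp
  qed
qed

instantiation abelianization :: (lie_ring) ab_group_add
begin

lift_definition zero_abelianization :: "'a abelianization" is 0 .

lift_definition plus_abelianization ::
  "'a abelianization \<Rightarrow> 'a abelianization \<Rightarrow> 'a abelianization" is "(+)"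
proof -
  fix x x' y y' :: 'a
  assume "x - x' \<in> lie_square" "y - y' \<in> lie_square"
  then have "(x - x') + (y - y') \<in> lie_square" by (rule lie_square_add)
  then show "(x + y) - (x' + y') \<in> lie_square" by (simp add: algebra_simps)
qed

lift_definition uminus_abelianization :: "'a abelianization \<Rightarrow> 'a abelianization" is uminus
proof -
  fix x x' :: 'a
  assume "x - x' \<in> lie_square"
  then have "- (x - x') \<in> lie_square" by (rule lie_square_uminus)
  then show "- x - - x' \<in> lie_square" by simp
qed

definition minus_abelianization ::
  "'a abelianization \<Rightarrow> 'a abelianization \<Rightarrow> 'a abelianization" where
  "minus_abelianization a b = a + - b"

instance
proof
  fix a b c :: "'a abelianization"
  show "a + b + c = a + (b + c)"
    by transfer (simp add: add.assoc lie_square_zero)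
  show "a + b = b + a"
    by transfer (simp add: add.commute lie_square_zero)
  show "0 + a = a"
    by transfer (simp add: lie_square_zero)
  show "- a + a = 0"
    by transfer (simp add: lie_square_zero)
  show "a - b = a + - b"
    by (rule minus_abelianization_def)
qed

end

text \<open>On Lie ring homomorphisms the next definition is the map induced on abelianizations, and the
  choice of representative does not matter.\<close>

definition ab_map :: "('a::lie_ring \<Rightarrow> 'b::lie_ring) \<Rightarrow> 'a abelianization \<Rightarrow> 'b abelianization" where
  "ab_map h X = ab_class (h (SOME x. ab_class x = X))"

lemma ab_class_eq_iff: "ab_class x = ab_class y \<longleftrightarrow> x - y \<in> lie_square"
  by (rule abelianization.abs_eq_iff)

lemma ab_map_ab_class:
  assumes "lie_hom h"
  shows "ab_map h (ab_class x) = ab_class (h x)"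
proof -
  have "ab_class (SOME y. ab_class y = ab_class x) = ab_class x"
    by (rule someI) simp
  then show ?thesis
    using lie_hom_lie_square[OF assms]
    by (simp add: ab_map_def ab_class_eq_iff flip: lie_hom_diff[OF assms])
qed

datatype 'a lie_term =
    TGen 'a
  | TZero
  | TAdd "'a lie_term" "'a lie_term"
  | TNeg "'a lie_term"
  | TBracket "'a lie_term" "'a lie_term"

inductive lie_eq :: "'a lie_term \<Rightarrow> 'a lie_term \<Rightarrow> bool" where
  lie_eq_refl: "lie_eq s s"
| lie_eq_sym: "lie_eq s t \<Longrightarrow> lie_eq t s"
| lie_eq_trans: "lie_eq s t \<Longrightarrow> lie_eq t u \<Longrightarrow> lie_eq s u"
| lie_eq_cong_add: "lie_eq s s' \<Longrightarrow> lie_eq t t' \<Longrightarrow> lie_eq (TAdd s t) (TAdd s' t')"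
| lie_eq_cong_neg: "lie_eq s s' \<Longrightarrow> lie_eq (TNeg s) (TNeg s')"
| lie_eq_cong_bracket: "lie_eq s s' \<Longrightarrow> lie_eq t t' \<Longrightarrow> lie_eq (TBracket s t) (TBracket s' t')"
| lie_eq_add_assoc: "lie_eq (TAdd (TAdd s t) u) (TAdd s (TAdd t u))"
| lie_eq_add_comm: "lie_eq (TAdd s t) (TAdd t s)"
| lie_eq_add_zero: "lie_eq (TAdd TZero s) s"
| lie_eq_add_neg: "lie_eq (TAdd (TNeg s) s) TZero"
| lie_eq_bracket_add_left:
    "lie_eq (TBracket (TAdd s t) u) (TAdd (TBracket s u) (TBracket t u))"
| lie_eq_bracket_add_right:
    "lie_eq (TBracket s (TAdd t u)) (TAdd (TBracket s t) (TBracket s u))"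
| lie_eq_bracket_self: "lie_eq (TBracket s s) TZero"
| lie_eq_jacobi:
    "lie_eq (TAdd (TAdd (TBracket s (TBracket t u)) (TBracket t (TBracket u s)))
        (TBracket u (TBracket s t))) TZero"

quotient_type 'a free_lie = "'a lie_term" / lie_eq
  by (rule equivpI) (auto intro: reflpI sympI transpI lie_eq_refl lie_eq_sym lie_eq_trans)

instantiation free_lie :: (type) lie_ring
begin

lift_definition zero_free_lie :: "'a free_lie" is TZero .

lift_definition plus_free_lie :: "'a free_lie \<Rightarrow> 'a free_lie \<Rightarrow> 'a free_lie" is TAdd
  by (rule lie_eq_cong_add)

lift_definition uminus_free_lie :: "'a free_lie \<Rightarrow> 'a free_lie" is TNeg
  by (rule lie_eq_cong_neg)

definition minus_free_lie :: "'a free_lie \<Rightarrow> 'a free_lie \<Rightarrow> 'a free_lie" where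
  "minus_free_lie a b = a + - b"

lift_definition bracket_free_lie :: "'a free_lie \<Rightarrow> 'a free_lie \<Rightarrow> 'a free_lie" is TBracket
  by (rule lie_eq_cong_bracket)

instance
proof
  fix a b c :: "'a free_lie"
  show "a + b + c = a + (b + c)" by transfer (rule lie_eq_add_assoc)
  show "a + b = b + a" by transfer (rule lie_eq_add_comm)
  show "0 + a = a" by transfer (rule lie_eq_add_zero)
  show "- a + a = 0" by transfer (rule lie_eq_add_neg)
  show "a - b = a + - b" by (rule minus_free_lie_def)
  show "bracket (a + b) c = bracket a c + bracket b c"
    by transfer (rule lie_eq_bracket_add_left)
  show "bracket a (b + c) = bracket a b + bracket a c"
    by transfer (rule lie_eq_bracket_add_right)
  show "bracket a a = 0" by transfer (rule lie_eq_bracket_self)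
  show "bracket a (bracket b c) + bracket b (bracket c a) + bracket c (bracket a b) = 0"
    by transfer (rule lie_eq_jacobi)
qed

end

lift_definition free_gen :: "'a \<Rightarrow> 'a free_lie" is TGen .

primrec eval_lie_term :: "('a \<Rightarrow> 'b::lie_ring) \<Rightarrow> 'a lie_term \<Rightarrow> 'b" where
  "eval_lie_term h (TGen a) = h a"
| "eval_lie_term h TZero = 0"
| "eval_lie_term h (TAdd s t) = eval_lie_term h s + eval_lie_term h t"
| "eval_lie_term h (TNeg s) = - eval_lie_term h s"
| "eval_lie_term h (TBracket s t) = bracket (eval_lie_term h s) (eval_lie_term h t)"

lift_definition free_lift :: "('a \<Rightarrow> 'b::lie_ring) \<Rightarrow> 'a free_lie \<Rightarrow> 'b" is eval_lie_term
proof -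
  fix h :: "'a \<Rightarrow> 'b" and s t :: "'a lie_term"
  assume "lie_eq s t"
  then show "eval_lie_term h s = eval_lie_term h t"
  proof induction
    case (lie_eq_jacobi s t u)
    show ?case by (simp add: jacobi)
  qed (simp_all add: ac_simps bracket_add_left bracket_add_right bracket_self)
qed

lemma free_lift_hom: "lie_hom (free_lift h)"
  unfolding lie_hom_def by (intro conjI allI; transfer; simp)

lemma free_lift_gen: "free_lift h (free_gen a) = h a"
  by transfer simp

lemma free_lift_unique:
  assumes "lie_hom g" "\<And>a. g (free_gen a) = h a"
  shows "g = free_lift h"
proof
  fix x
  have "g (abs_free_lie t) = free_lift h (abs_free_lie t)" for t
  proof (induction t)
    case (TGen a)
    then show ?case using assms(2)[of a] by (simp add: free_gen.abs_eq free_lift.abs_eq)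
  next
    case TZero
    then show ?case
      using lie_hom_zero[OF assms(1)] lie_hom_zero[OF free_lift_hom[of h]]
      by (simp add: zero_free_lie_def)
  next
    case (TAdd s t)
    then show ?case
      using assms(1) free_lift_hom[of h]
      by (simp add: lie_hom_def flip: plus_free_lie.abs_eq)
  next
    case (TNeg s)
    then show ?case
      by (simp add: lie_hom_minus[OF assms(1)] lie_hom_minus[OF free_lift_hom]
          flip: uminus_free_lie.abs_eq)
  next
    case (TBracket s t)
    then show ?case
      using assms(1) free_lift_hom[of h]
      by (simp add: lie_hom_def flip: bracket_free_lie.abs_eq)
  qed
  then show "g x = free_lift h x" by (metis Quotient_free_lie Quotient_abs_rep)
qed

definition free_map :: "('a \<Rightarrow> 'b) \<Rightarrow> 'a free_lie \<Rightarrow> 'b free_lie" where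
  "free_map h = free_lift (free_gen \<circ> h)"

definition free_counit :: "'a::lie_ring free_lie \<Rightarrow> 'a" where
  "free_counit = free_lift id"

text \<open>Write \<open>G\<close> for the comonad of the free/forgetful adjunction between Lie rings and sets and
  \<open>\<epsilon>\<close> for its counit. The comonad resolution of \<open>L\<close> has \<open>F\<^sub>n = G\<^sup>n\<^sup>+\<^sup>1 L\<close> in degree \<open>n\<close>, with
  faces \<open>d\<^sub>i = G\<^sup>i \<epsilon> G\<^sup>n\<^sup>-\<^sup>i\<close> from \<open>F\<^sub>n\<close> to \<open>F\<^sub>n\<^sub>-\<^sub>1\<close> for \<open>0 \<le> i \<le> n\<close>. The \<open>F\<^sub>n\<close> are pairwise
  different types, so there is no single constant for the whole simplicial object; the first
  homotopy group is determined by the faces out of \<open>F\<^sub>1\<close> and \<open>F\<^sub>2\<close>, which are given here.\<close>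

type_synonym 'a res0 = "'a free_lie"
type_synonym 'a res1 = "'a free_lie free_lie"
type_synonym 'a res2 = "'a free_lie free_lie free_lie"

definition res_face1 :: "nat \<Rightarrow> 'a::lie_ring res1 \<Rightarrow> 'a res0" where
  "res_face1 i = (if i = 0 then free_counit else free_map free_counit)"

definition res_face2 :: "nat \<Rightarrow> 'a::lie_ring res2 \<Rightarrow> 'a res1" where
  "res_face2 i =
    (if i = 0 then free_counit
     else if i = 1 then free_map free_counit
     else free_map (free_map free_counit))"

text \<open>The \<open>n\<close>-th homotopy group, \<open>n \<ge> 1\<close>, of a simplicial abelian group \<open>A\<close> with faces
  \<open>d i : A\<^sub>n \<rightarrow> A\<^sub>n\<^sub>-\<^sub>1\<close> and \<open>d' i : A\<^sub>n\<^sub>+\<^sub>1 \<rightarrow> A\<^sub>n\<close>: elements with all faces zero, modulo the last faces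
  of elements whose other faces vanish.\<close>

definition simplicial_pi ::
  "nat \<Rightarrow> (nat \<Rightarrow> 'b::ab_group_add \<Rightarrow> 'a::ab_group_add) \<Rightarrow> (nat \<Rightarrow> 'c::ab_group_add \<Rightarrow> 'b)
    \<Rightarrow> 'b set monoid" where
  "simplicial_pi n d d' =
    \<lparr>carrier = {x. \<forall>i\<le>n. d i x = 0}, monoid.mult = (+), one = 0\<rparr>
      Mod {d' (Suc n) y | y. \<forall>i\<le>n. d' i y = 0}"

definition schur_multiplier :: "'a::lie_ring itself \<Rightarrow> 'a res1 abelianization set monoid" where
  "schur_multiplier _ =
    simplicial_pi 1
      (\<lambda>i. ab_map (res_face1 i) :: 'a res1 abelianization \<Rightarrow> 'a res0 abelianization)
      (\<lambda>i. ab_map (res_face2 i) :: 'a res2 abelianization \<Rightarrow> 'a res1 abelianization)"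

text \<open>The coefficient group \<open>A\<close> is written multiplicatively.\<close>

definition lie_Z2 ::
  "'a::lie_ring itself \<Rightarrow> ('b, 'm) monoid_scheme
    \<Rightarrow> (('a \<Rightarrow> 'a \<Rightarrow> 'b) \<times> ('a \<Rightarrow> 'a \<Rightarrow> 'b)) monoid" where
  "lie_Z2 _ A =
    \<lparr>carrier = {(f, g).
        (\<forall>x y. f x y \<in> carrier A \<and> g x y \<in> carrier A) \<and>
        (\<forall>x y z. f (x + y) z = f x z \<otimes>\<^bsub>A\<^esub> f y z \<otimes>\<^bsub>A\<^esub> g (bracket x z) (bracket y z)) \<and>
        (\<forall>x y z. f x (y + z) = f x y \<otimes>\<^bsub>A\<^esub> f x z \<otimes>\<^bsub>A\<^esub> g (bracket x y) (bracket x z)) \<and>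
        (\<forall>x. f x x = \<one>\<^bsub>A\<^esub>) \<and>
        (\<forall>x y z. f x (bracket y z) \<otimes>\<^bsub>A\<^esub> f z (bracket x y) \<otimes>\<^bsub>A\<^esub> f y (bracket z x) =
           inv\<^bsub>A\<^esub> (g (bracket x (bracket y z)) (bracket z (bracket x y))) \<otimes>\<^bsub>A\<^esub>
           inv\<^bsub>A\<^esub> (g (- bracket y (bracket z x)) (bracket y (bracket z x)))) \<and>
        (\<forall>x y z. g (x + y) z \<otimes>\<^bsub>A\<^esub> g x y = g x (y + z) \<otimes>\<^bsub>A\<^esub> g y z) \<and>
        (\<forall>x y. g x y = g y x)},
      monoid.mult = (\<lambda>(f, g) (f', g'). (\<lambda>x y. f x y \<otimes>\<^bsub>A\<^esub> f' x y, \<lambda>x y. g x y \<otimes>\<^bsub>A\<^esub> g' x y)),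
      one = (\<lambda>x y. \<one>\<^bsub>A\<^esub>, \<lambda>x y. \<one>\<^bsub>A\<^esub>)\<rparr>"

definition lie_B2 ::
  "'a::lie_ring itself \<Rightarrow> ('b, 'm) monoid_scheme
    \<Rightarrow> (('a \<Rightarrow> 'a \<Rightarrow> 'b) \<times> ('a \<Rightarrow> 'a \<Rightarrow> 'b)) set" where
  "lie_B2 _ A =
    {(\<lambda>x y. inv\<^bsub>A\<^esub> (t (bracket x y)), \<lambda>x y. t x \<otimes>\<^bsub>A\<^esub> t y \<otimes>\<^bsub>A\<^esub> inv\<^bsub>A\<^esub> (t (x + y))) | t.
      (\<forall>x. t x \<in> carrier A) \<and> t 0 = \<one>\<^bsub>A\<^esub>}"

definition lie_H2 ::
  "'a::lie_ring itself \<Rightarrow> ('b, 'm) monoid_scheme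
    \<Rightarrow> (('a \<Rightarrow> 'a \<Rightarrow> 'b) \<times> ('a \<Rightarrow> 'a \<Rightarrow> 'b)) set monoid" where
  "lie_H2 L A = lie_Z2 L A Mod lie_B2 L A"

definition complex_units :: "complex monoid" where
  "complex_units = \<lparr>carrier = UNIV - {0}, monoid.mult = (*), one = 1\<rparr>"

end

theory Submission
  imports Defs "HOL-Algebra.Multiplicative_Group" "HOL-Computational_Algebra.Primes"
    "HOL-Library.Product_Plus"
begin

text \<open>Write \<open>F\<close> for the free Lie ring functor and \<open>\<epsilon>\<close> for its counit. A cocycle \<open>(f, g)\<close> with values
  in \<open>\<complex>\<^sup>*\<close> determines a central extension of \<open>L\<close>, hence a map \<open>\<phi> : F L \<rightarrow> \<complex>\<^sup>*\<close> that vanishes on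
  generators and satisfies \<open>\<phi>(u + v) = \<phi>(u) + \<phi>(v) + g(\<epsilon> u, \<epsilon> v)\<close> and \<open>\<phi>[u, v] = f(\<epsilon> u, \<epsilon> v)\<close>.
  Its linear extension to the free abelian group \<open>\<int>[F L]\<close>, the abelianization of \<open>F F L\<close>, vanishes on
  boundaries and so induces a character of \<open>M(L)\<close>. Because \<open>\<complex>\<^sup>*\<close> is divisible, a homomorphism vanishing
  on the kernel of \<open>(d\<^sub>0, d\<^sub>1)\<close> factors through \<open>(d\<^sub>0, d\<^sub>1)\<close>; this shows both that \<open>(f, g)\<close> is a coboundary
  if its character is trivial, and that every character arises from a cocycle. Hence
  \<open>H\<^sup>2(L, \<complex>\<^sup>*) \<cong> Hom(M(L), \<complex>\<^sup>*)\<close> for every Lie ring. For finite \<open>L\<close> every class contains a cocycle with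
  \<open>g = 0\<close>, for which \<open>f\<close> is biadditive and takes values in the roots of unity of order dividing \<open>|L|\<close>;
  so \<open>M(L)\<close> has finitely many characters, is finite, and is isomorphic to its group of characters.\<close>

section \<open>Extension of homomorphisms into divisible groups\<close>

text \<open>The subgroup generated by \<open>T\<close> and \<open>z\<close>. It enlarges a partial
  graph by one point, and for trivial \<open>T\<close> it is cyclic.\<close>

lemma (in comm_group) subgroup_adjoin:
  assumes T: "subgroup T G" and z: "z \<in> carrier G"
  shows "subgroup {t \<otimes> z [^] k |t k. t \<in> T \<and> k \<in> (UNIV :: int set)} G" (is "subgroup ?S G")
proof (rule subgroupI)
  show "?S \<subseteq> carrier G"
    using subgroup.subset[OF T] z by auto
  show "?S \<noteq> {}"
    using subgroup.one_closed[OF T] by auto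
next
  fix a assume "a \<in> ?S"
  then obtain t and k :: int where a: "a = t \<otimes> z [^] k" "t \<in> T" by auto
  have "inv a = inv t \<otimes> z [^] (- k)"
    using a z subgroup.mem_carrier[OF T] by (simp add: inv_mult int_pow_neg)
  then show "inv a \<in> ?S"
    using a subgroup.m_inv_closed[OF T] by blast
next
  fix a b assume "a \<in> ?S" "b \<in> ?S"
  then obtain t u and k l :: int
    where a: "a = t \<otimes> z [^] k" "t \<in> T" and b: "b = u \<otimes> z [^] l" "u \<in> T" by auto
  have "a \<otimes> b = (t \<otimes> u) \<otimes> z [^] (k + l)"
    using a b z subgroup.mem_carrier[OF T] by (simp add: int_pow_mult m_ac)
  then show "a \<otimes> b \<in> ?S"
    using a b subgroup.m_closed[OF T] by blast
qed

lemma (in group) subgroup_Union_chain: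
  assumes ne: "C \<noteq> {}" and sub: "\<And>T. T \<in> C \<Longrightarrow> subgroup T G"
    and chain: "\<And>S T. S \<in> C \<Longrightarrow> T \<in> C \<Longrightarrow> S \<subseteq> T \<or> T \<subseteq> S"
  shows "subgroup (\<Union>C) G"
proof (rule subgroupI)
  show "\<Union>C \<subseteq> carrier G"
    using sub subgroup.subset by blast
  show "\<Union>C \<noteq> {}"
    using ne sub subgroup.one_closed by blast
  show "inv a \<in> \<Union>C" if "a \<in> \<Union>C" for a
    using that subgroup.m_inv_closed[OF sub] by auto
  fix a b assume "a \<in> \<Union>C" "b \<in> \<Union>C"
  then obtain S T where ST: "S \<in> C" "T \<in> C" "a \<in> S" "b \<in> T" by blast
  with chain[of S T] obtain R where "R \<in> C" "a \<in> R" "b \<in> R" by blast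
  then show "a \<otimes> b \<in> \<Union>C"
    using subgroup.m_closed[OF sub] by auto
qed

lemma DirProd_comm_group:
  assumes "comm_group G" "comm_group H"
  shows "comm_group (G \<times>\<times> H)"
proof -
  interpret G: comm_group G by fact
  interpret H: comm_group H by fact
  interpret GH: group "G \<times>\<times> H" by (rule DirProd_group) unfold_locales
  show ?thesis
    by (rule GH.group_comm_groupI) (auto simp: G.m_comm H.m_comm)
qed

lemma DirProd_nat_pow:
  "(x, y) [^]\<^bsub>G \<times>\<times> H\<^esub> (n :: nat) = (x [^]\<^bsub>G\<^esub> n, y [^]\<^bsub>H\<^esub> n)"
  by (induction n) simp_all

lemma DirProd_int_pow:
  assumes "group G" "group H" "x \<in> carrier G" "y \<in> carrier H"
  shows "(x, y) [^]\<^bsub>G \<times>\<times> H\<^esub> (k :: int) = (x [^]\<^bsub>G\<^esub> k, y [^]\<^bsub>H\<^esub> k)"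
proof -
  interpret G: group G by fact
  interpret H: group H by fact
  interpret GH: group "G \<times>\<times> H" by (rule DirProd_group) fact+
  show ?thesis
    using assms(3,4) by (cases k rule: int_cases2)
      (simp_all add: int_pow_int DirProd_nat_pow G.int_pow_neg_int H.int_pow_neg_int GH.int_pow_neg_int)
qed

definition divisible_group :: "('a, 'm) monoid_scheme \<Rightarrow> bool" where
  "divisible_group A \<longleftrightarrow> (\<forall>a\<in>carrier A. \<forall>n::nat. 0 < n \<longrightarrow> (\<exists>b\<in>carrier A. b [^]\<^bsub>A\<^esub> n = a))"

text \<open>A subgroup \<open>S\<close> of \<open>G \<times> A\<close> meeting \<open>1 \<times> A\<close> trivially is the graph of a homomorphism from a
  subgroup of \<open>G\<close> to \<open>A\<close>.\<close>

lemma (in comm_group) divisible_extension_step: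
  assumes A: "comm_group A" and div: "divisible_group A"
    and T: "subgroup T (G \<times>\<times> A)" and single: "\<And>a. (\<one>, a) \<in> T \<Longrightarrow> a = \<one>\<^bsub>A\<^esub>"
    and x: "x \<in> carrier G"
  obtains T' b where "subgroup T' (G \<times>\<times> A)" "\<And>a. (\<one>, a) \<in> T' \<Longrightarrow> a = \<one>\<^bsub>A\<^esub>" "T \<subseteq> T'" "(x, b) \<in> T'"
proof -
  interpret A: comm_group A by fact
  interpret GA: comm_group "G \<times>\<times> A" by (intro DirProd_comm_group A) unfold_locales
  have pow: "(y, a) [^]\<^bsub>G \<times>\<times> A\<^esub> (k :: int) = (y [^] k, a [^]\<^bsub>A\<^esub> k)"
    if "y \<in> carrier G" "a \<in> carrier A" for y a k
    using that by (intro DirProd_int_pow) unfold_locales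
  have T_pow: "(y [^] k, a [^]\<^bsub>A\<^esub> k) \<in> T" if "(y, a) \<in> T" for y a and k :: int
    using that GA.subgroup_int_pow_closed[OF T that, of k] subgroup.mem_carrier[OF T that]
    by (simp add: pow)
  have T_mult: "(y \<otimes> z, a \<otimes>\<^bsub>A\<^esub> c) \<in> T" if "(y, a) \<in> T" "(z, c) \<in> T" for y z a c
    using subgroup.m_closed[OF T that] by simp
  \<comment> \<open>The quotient of two points of \<open>T\<close> over the same \<open>y\<close>
    lies over \<open>\<one>\<close>.\<close>
  have T_unique: "a = c" if "(y, a) \<in> T" "(y, c) \<in> T" for y a c
  proof -
    have carr: "y \<in> carrier G" "a \<in> carrier A" "c \<in> carrier A"
      using that subgroup.mem_carrier[OF T] by auto
    have "(y \<otimes> y [^] (-1::int), a \<otimes>\<^bsub>A\<^esub> c [^]\<^bsub>A\<^esub> (-1::int)) \<in> T"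
      using T_mult[OF that(1) T_pow[OF that(2)]] .
    then have "a \<otimes>\<^bsub>A\<^esub> inv\<^bsub>A\<^esub> c = \<one>\<^bsub>A\<^esub>"
      using carr by (intro single) (simp add: int_pow_neg A.int_pow_neg)
    then show ?thesis
      using carr A.inv_equality A.inv_inv by fastforce
  qed
  \<comment> \<open>A value \<open>b\<close> at \<open>x\<close> is admissible if it agrees with
    \<open>T\<close> on those powers of \<open>x\<close> that \<open>T\<close> already
    covers.\<close>
  have "\<exists>b\<in>carrier A. \<forall>a. \<forall>k::int. (x [^] k, a) \<in> T \<longrightarrow> a = b [^]\<^bsub>A\<^esub> k"
  proof (cases "\<exists>n::nat. 0 < n \<and> (\<exists>a. (x [^] n, a) \<in> T)")
    \<comment> \<open>\<open>T\<close> covers \<open>x [^] k\<close> only for \<open>k = 0\<close>,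
      so \<open>b\<close> is unconstrained and the unit is taken.\<close>
    case False
    have "k = 0" if "(x [^] k, a) \<in> T" for a and k :: int
    proof (rule ccontr)
      assume "k \<noteq> 0"
      have "(x [^] (- k), a [^]\<^bsub>A\<^esub> (- 1 :: int)) \<in> T"
        using T_pow[OF that, of "- 1"] x by (simp add: int_pow_pow)
      with that have "\<exists>a. (x [^] int (nat \<bar>k\<bar>), a) \<in> T"
        by (cases "0 \<le> k") auto
      then have "\<exists>a. (x [^] nat \<bar>k\<bar>, a) \<in> T"
        unfolding int_pow_int .
      moreover have "0 < nat \<bar>k\<bar>"
        using \<open>k \<noteq> 0\<close> by simp
      ultimately show False using False by blast
    qed
    then show ?thesis
      using single by (intro bexI[of _ "\<one>\<^bsub>A\<^esub>"]) fastforce+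
  next
    case True
    \<comment> \<open>The exponents \<open>k\<close> with \<open>x [^] k\<close> covered by
      \<open>T\<close> are the multiples of the least positive one, \<open>n\<close>. Divisibility
      provides an \<open>n\<close>-th root \<open>b\<close> of the value \<open>c\<close> at
      \<open>x [^] n\<close>.\<close>
    define n where "n = (LEAST n::nat. 0 < n \<and> (\<exists>a. (x [^] n, a) \<in> T))"
    have n: "0 < n" "\<exists>a. (x [^] n, a) \<in> T"
      using LeastI_ex[OF True] by (simp_all add: n_def)
    have least: "n \<le> m" if "0 < m" "(x [^] m, a) \<in> T" for m a
      unfolding n_def using that by (intro Least_le) auto
    from n(2) obtain c where c: "(x [^] n, c) \<in> T" by blast
    then have "c \<in> carrier A"
      using subgroup.mem_carrier[OF T c] by simp
    then obtain b where b: "b \<in> carrier A" "b [^]\<^bsub>A\<^esub> n = c"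
      using div n(1) unfolding divisible_group_def by blast
    have nb: "(x [^] (int n * q), b [^]\<^bsub>A\<^esub> (int n * q)) \<in> T" for q
      using T_pow[OF c, of q] b x
      by (simp add: int_pow_int flip: int_pow_pow A.int_pow_pow)
    have "a = b [^]\<^bsub>A\<^esub> k" if ka: "(x [^] k, a) \<in> T" for a and k :: int
    proof -
      have "k mod int n = 0"
      proof (rule ccontr)
        assume r: "k mod int n \<noteq> 0"
        have "k mod int n = k + int n * (- (k div int n))"
          by (simp add: minus_mult_div_eq_mod[symmetric])
        then have "x [^] k \<otimes> x [^] (int n * (- (k div int n))) = x [^] (k mod int n)"
          using int_pow_mult[OF x, of k "int n * (- (k div int n))"] by (simp only:)
        moreover have "x [^] (k mod int n) = x [^] nat (k mod int n)"
        proof -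
          have "int (nat (k mod int n)) = k mod int n" using n(1) by simp
          with int_pow_int[of G x "nat (k mod int n)"] show ?thesis by (simp only:)
        qed
        ultimately have "(x [^] nat (k mod int n), a \<otimes>\<^bsub>A\<^esub> b [^]\<^bsub>A\<^esub> (int n * (- (k div int n)))) \<in> T"
          using T_mult[OF ka nb[of "- (k div int n)"]] by (simp only:)
        then have "\<exists>a. (x [^] nat (k mod int n), a) \<in> T" by (rule exI)
        moreover have "0 < nat (k mod int n)"
          using r n(1) pos_mod_sign[of "int n" k] by linarith
        ultimately have "n \<le> nat (k mod int n)"
          using least by blast
        then show False
          using n(1) pos_mod_bound[of "int n" k] by linarith
      qed
      then have "int n * (k div int n) = k" by auto
      with nb[of "k div int n"] have "(x [^] k, b [^]\<^bsub>A\<^esub> k) \<in> T" by (simp only:)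
      with ka show ?thesis by (rule T_unique)
    qed
    with b(1) show ?thesis by blast
  qed
  then obtain b where b: "b \<in> carrier A" "\<And>a k::int. (x [^] k, a) \<in> T \<Longrightarrow> a = b [^]\<^bsub>A\<^esub> k"
    by blast
  let ?T' = "{t \<otimes>\<^bsub>G \<times>\<times> A\<^esub> (x, b) [^]\<^bsub>G \<times>\<times> A\<^esub> k |t k. t \<in> T \<and> k \<in> (UNIV :: int set)}"
  show thesis
  proof
    show "subgroup ?T' (G \<times>\<times> A)"
      using x b(1) by (intro GA.subgroup_adjoin T) simp
    show "T \<subseteq> ?T'"
    proof
      fix t assume "t \<in> T"
      then have "t = t \<otimes>\<^bsub>G \<times>\<times> A\<^esub> (x, b) [^]\<^bsub>G \<times>\<times> A\<^esub> (0::int)"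
        using GA.r_one[OF subgroup.mem_carrier[OF T \<open>t \<in> T\<close>]] by simp
      with \<open>t \<in> T\<close> show "t \<in> ?T'" by blast
    qed
    have "(x, b) = \<one>\<^bsub>G \<times>\<times> A\<^esub> \<otimes>\<^bsub>G \<times>\<times> A\<^esub> (x, b) [^]\<^bsub>G \<times>\<times> A\<^esub> (1::int)"
      using x b(1) by (simp add: pow)
    then show "(x, b) \<in> ?T'"
      using subgroup.one_closed[OF T] by blast
    \<comment> \<open>Over \<open>\<one>\<close>, the factor from \<open>T\<close> lies over a power
      of \<open>x\<close>, where \<open>T\<close> and \<open>b\<close> agree, so the two factors
      cancel.\<close>
    fix a assume "(\<one>, a) \<in> ?T'"
    then obtain y c and k :: int where yc: "(y, c) \<in> T" and
      eq: "\<one> = y \<otimes> x [^] k" "a = c \<otimes>\<^bsub>A\<^esub> b [^]\<^bsub>A\<^esub> k"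
      using x b(1) by (auto simp: pow)
    have "y = x [^] (- k)"
      using eq(1) x subgroup.mem_carrier[OF T yc] inv_equality[of y "x [^] k"]
      by (simp add: int_pow_neg)
    then have "c = b [^]\<^bsub>A\<^esub> (- k)"
      using yc b(2) by blast
    then show "a = \<one>\<^bsub>A\<^esub>"
      using eq(2) b(1) by (simp add: A.int_pow_neg)
  qed
qed

text \<open>Zorn's lemma gives a maximal graph containing \<open>S\<close>. Since
  \<open>divisible_extension_step\<close> adjoins any missing point of \<open>G\<close>, it is
  defined on all of \<open>G\<close> and is the graph of \<open>\<chi>\<close>.\<close>

theorem (in comm_group) divisible_extension:
  assumes A: "comm_group A" and div: "divisible_group A"
    and S: "subgroup S (G \<times>\<times> A)" and single: "\<And>a. (\<one>, a) \<in> S \<Longrightarrow> a = \<one>\<^bsub>A\<^esub>"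
  obtains \<chi> where "\<chi> \<in> hom G A" "\<And>x a. (x, a) \<in> S \<Longrightarrow> \<chi> x = a"
proof -
  interpret A: comm_group A by fact
  interpret GA: comm_group "G \<times>\<times> A" by (intro DirProd_comm_group A) unfold_locales
  define \<T> where "\<T> = {T. subgroup T (G \<times>\<times> A) \<and> (\<forall>a. (\<one>, a) \<in> T \<longrightarrow> a = \<one>\<^bsub>A\<^esub>) \<and> S \<subseteq> T}"
  have "\<exists>T\<in>\<T>. \<forall>T'\<in>\<T>. T \<subseteq> T' \<longrightarrow> T' = T"
  proof (rule subset_Zorn_nonempty)
    show "\<T> \<noteq> {}"
      using S single unfolding \<T>_def by blast
    fix C assume C: "C \<noteq> {}" "subset.chain \<T> C"
    then have "subgroup (\<Union>C) (G \<times>\<times> A)"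
      by (intro GA.subgroup_Union_chain) (auto simp: subset_chain_def \<T>_def)
    with C show "\<Union>C \<in> \<T>"
      unfolding \<T>_def subset_chain_def by blast
  qed
  then obtain T where T: "T \<in> \<T>" and max: "\<And>T'. T' \<in> \<T> \<Longrightarrow> T \<subseteq> T' \<Longrightarrow> T' = T"
    by blast
  have sub: "subgroup T (G \<times>\<times> A)" and T1: "\<And>a. (\<one>, a) \<in> T \<Longrightarrow> a = \<one>\<^bsub>A\<^esub>" and "S \<subseteq> T"
    using T by (auto simp: \<T>_def)
  have total: "\<exists>a. (x, a) \<in> T" if x: "x \<in> carrier G" for x
  proof -
    obtain T' b where T': "subgroup T' (G \<times>\<times> A)" "\<And>a. (\<one>, a) \<in> T' \<Longrightarrow> a = \<one>\<^bsub>A\<^esub>" "T \<subseteq> T'" "(x, b) \<in> T'"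
      using divisible_extension_step[OF A div sub T1 x] by blast
    then have "T' = T"
      using \<open>S \<subseteq> T\<close> by (intro max) (auto simp: \<T>_def)
    with T' show ?thesis by blast
  qed
  have unique: "a = c" if "(x, a) \<in> T" "(x, c) \<in> T" for x a c
  proof -
    have carr: "x \<in> carrier G" "a \<in> carrier A" "c \<in> carrier A"
      using that subgroup.mem_carrier[OF sub] by auto
    have "(x, a) \<otimes>\<^bsub>G \<times>\<times> A\<^esub> inv\<^bsub>G \<times>\<times> A\<^esub> (x, c) \<in> T"
      using that sub subgroup.m_closed subgroup.m_inv_closed by metis
    then have "a \<otimes>\<^bsub>A\<^esub> inv\<^bsub>A\<^esub> c = \<one>\<^bsub>A\<^esub>"
      using carr by (intro T1) (simp add: inv_DirProd[OF is_group A.is_group])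
    then show ?thesis
      using carr A.inv_equality A.inv_inv by fastforce
  qed
  define \<chi> where "\<chi> x = (THE a. (x, a) \<in> T)" for x
  have \<chi>: "\<chi> x = a" if "(x, a) \<in> T" for x a
    unfolding \<chi>_def using that unique by blast
  have \<chi>_mem: "(x, \<chi> x) \<in> T" if "x \<in> carrier G" for x
    using total[OF that] \<chi> by blast
  show thesis
  proof
    show "\<chi> \<in> hom G A"
    proof (rule homI)
      show "\<chi> x \<in> carrier A" if "x \<in> carrier G" for x
        using subgroup.mem_carrier[OF sub \<chi>_mem[OF that]] by simp
      show "\<chi> (x \<otimes> y) = \<chi> x \<otimes>\<^bsub>A\<^esub> \<chi> y" if "x \<in> carrier G" "y \<in> carrier G" for x y
        using subgroup.m_closed[OF sub \<chi>_mem[OF that(1)] \<chi>_mem[OF that(2)]] by (intro \<chi>) simp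
    qed
    show "\<chi> x = a" if "(x, a) \<in> S" for x a
      using that \<open>S \<subseteq> T\<close> by (blast intro: \<chi>)
  qed
qed

section \<open>Characters of abelian groups\<close>

lemma carrier_complex_units [simp]: "carrier complex_units = UNIV - {0}"
  and mult_complex_units [simp]: "x \<otimes>\<^bsub>complex_units\<^esub> y = x * y"
  and one_complex_units [simp]: "\<one>\<^bsub>complex_units\<^esub> = 1"
  by (simp_all add: complex_units_def)

lemma comm_group_complex_units: "comm_group complex_units"
proof (rule comm_groupI)
  show "\<exists>y\<in>carrier complex_units. y \<otimes>\<^bsub>complex_units\<^esub> x = \<one>\<^bsub>complex_units\<^esub>"
    if "x \<in> carrier complex_units" for x
    using that by (intro bexI[of _ "inverse x"]) simp_all
qed (simp_all add: mult_ac)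

interpretation complex_units: comm_group complex_units
  by (rule comm_group_complex_units)

lemma inv_complex_units [simp]: "z \<noteq> 0 \<Longrightarrow> inv\<^bsub>complex_units\<^esub> z = inverse z"
  by (rule complex_units.inv_equality) simp_all

lemma nat_pow_complex_units [simp]: "z [^]\<^bsub>complex_units\<^esub> (n :: nat) = z ^ n"
  by (induction n) (simp_all add: mult.commute)

lemma int_pow_complex_units [simp]:
  assumes "z \<noteq> 0"
  shows "z [^]\<^bsub>complex_units\<^esub> (k :: int) = z powi k"
  using assms by (cases k rule: int_cases2)
    (simp_all add: int_pow_int complex_units.int_pow_neg_int power_int_minus)

lemma hom_complex_unitsD:
  assumes "group G" "\<chi> \<in> hom G complex_units"
  shows "x \<in> carrier G \<Longrightarrow> \<chi> x \<noteq> 0"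
    and "x \<in> carrier G \<Longrightarrow> y \<in> carrier G \<Longrightarrow> \<chi> (x \<otimes>\<^bsub>G\<^esub> y) = \<chi> x * \<chi> y"
    and "\<chi> \<one>\<^bsub>G\<^esub> = 1"
    and "x \<in> carrier G \<Longrightarrow> \<chi> (x [^]\<^bsub>G\<^esub> (k :: int)) = \<chi> x powi k"
    and "x \<in> carrier G \<Longrightarrow> \<chi> (inv\<^bsub>G\<^esub> x) = inverse (\<chi> x)"
proof -
  interpret group_hom G complex_units \<chi>
    using assms by (simp add: group_hom_def group_hom_axioms_def complex_units.is_group)
  show nz: "x \<in> carrier G \<Longrightarrow> \<chi> x \<noteq> 0" for x
    using hom_closed by auto
  show "x \<in> carrier G \<Longrightarrow> y \<in> carrier G \<Longrightarrow> \<chi> (x \<otimes>\<^bsub>G\<^esub> y) = \<chi> x * \<chi> y"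
    by simp
  show "\<chi> \<one>\<^bsub>G\<^esub> = 1"
    using hom_one by simp
  show "x \<in> carrier G \<Longrightarrow> \<chi> (x [^]\<^bsub>G\<^esub> (k :: int)) = \<chi> x powi k"
    using hom_int_pow[of x k] nz[of x] by simp
  show "x \<in> carrier G \<Longrightarrow> \<chi> (inv\<^bsub>G\<^esub> x) = inverse (\<chi> x)"
    using nz[of x] by simp
qed

lemma divisible_complex_units: "divisible_group complex_units"
  unfolding divisible_group_def
proof (intro ballI allI impI)
  fix a and n :: nat assume "a \<in> carrier complex_units" "0 < n"
  then have "card {z. z ^ n = a} \<noteq> 0"
    by (simp add: card_nth_roots)
  then obtain z where "z ^ n = a"
    by (metis (mono_tags) card_eq_0_iff empty_Collect_eq)
  with \<open>a \<in> carrier complex_units\<close> \<open>0 < n\<close>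
  show "\<exists>b\<in>carrier complex_units. b [^]\<^bsub>complex_units\<^esub> n = a"
    by (intro bexI[of _ z]) (auto simp: zero_power)
qed

text \<open>The powers of \<open>\<omega>\<close> with exponents below \<open>n\<close> list the
  \<open>n\<close>-th roots of unity without repetition. Both claims are read off from this
  bijection.\<close>

lemma cis_root_of_unity:
  fixes n :: nat
  assumes "0 < n"
  defines "\<omega> \<equiv> cis (2 * pi / real n)"
  shows "\<omega> powi k = 1 \<longleftrightarrow> int n dvd k"
    and "z ^ n = 1 \<Longrightarrow> \<exists>k::int. z = \<omega> powi k"
proof -
  have nz: "\<omega> \<noteq> 0" by (simp add: \<omega>_def)
  have pow: "\<omega> ^ k = cis (2 * pi * real k / real n)" for k
    by (simp add: \<omega>_def DeMoivre mult_ac)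
  have bij: "bij_betw (\<lambda>k. \<omega> ^ k) {..<n} {z. z ^ n = 1}"
    using bij_betw_roots_unity[OF assms(1)] by (simp add: pow)
  show "\<exists>k::int. z = \<omega> powi k" if "z ^ n = 1"
  proof -
    from that have "z \<in> (\<lambda>k. \<omega> ^ k) ` {..<n}"
      using bij by (simp add: bij_betw_def)
    then obtain k where "z = \<omega> ^ k" by blast
    then show ?thesis by (intro exI[of _ "int k"]) simp
  qed
  have n1: "\<omega> ^ n = 1"
    using pow[of n] assms by simp
  show "\<omega> powi k = 1 \<longleftrightarrow> int n dvd k"
  proof -
    have "\<omega> powi k = \<omega> powi (int n * (k div int n) + k mod int n)" by simp
    also have "\<dots> = \<omega> powi (k mod int n)"
      using nz n1 by (subst power_int_add) (simp_all add: power_int_mult)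
    also have "\<dots> = \<omega> powi int (nat (k mod int n))"
      using assms by simp
    finally have "\<omega> powi k = \<omega> ^ nat (k mod int n)"
      by (simp only: power_int_of_nat)
    moreover have "nat (k mod int n) < n"
      using pos_mod_bound[of "int n" k] assms by linarith
    then have "\<omega> ^ nat (k mod int n) = \<omega> ^ 0 \<longleftrightarrow> nat (k mod int n) = 0"
      using inj_on_eq_iff[OF bij_betw_imp_inj_on[OF bij], of "nat (k mod int n)" 0] assms
      by (simp only: lessThan_iff)
    moreover have "nat (k mod int n) = 0 \<longleftrightarrow> int n dvd k"
      unfolding dvd_eq_mod_eq_0 using assms pos_mod_sign[of "int n" k] by linarith
    ultimately show ?thesis by simp
  qed
qed

section \<open>Characters with prescribed values\<close>

text \<open>By the assumption \<open>ord\<close>, the cyclic subgroup generated by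
  \<open>(g, a)\<close> in \<open>G \<times>\<times> complex_units\<close> is the graph of a
  homomorphism on the powers of \<open>g\<close>. Divisibility of \<open>complex_units\<close>
  extends it to \<open>G\<close>.\<close>

lemma (in comm_group) character_extending_cyclic:
  assumes g: "g \<in> carrier G" and a: "a \<noteq> 0" and ord: "\<And>k::int. g [^] k = \<one> \<Longrightarrow> a powi k = 1"
  obtains \<chi> where "\<chi> \<in> hom G complex_units" "\<chi> g = a"
proof -
  interpret GC: comm_group "G \<times>\<times> complex_units"
    by (intro DirProd_comm_group comm_group_complex_units) unfold_locales
  have pow: "(g, a) [^]\<^bsub>G \<times>\<times> complex_units\<^esub> (k :: int) = (g [^] k, a powi k)" for k
    using g a DirProd_int_pow[OF is_group complex_units.is_group, of g a k] by simp
  let ?S = "{t \<otimes>\<^bsub>G \<times>\<times> complex_units\<^esub> (g, a) [^]\<^bsub>G \<times>\<times> complex_units\<^esub> k |t k.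
    t \<in> {\<one>\<^bsub>G \<times>\<times> complex_units\<^esub>} \<and> k \<in> (UNIV :: int set)}"
  have S: "?S = range (\<lambda>k::int. (g [^] k, a powi k))"
    using g by (auto simp: pow)
  have "subgroup ?S (G \<times>\<times> complex_units)"
    using g a by (intro GC.subgroup_adjoin GC.triv_subgroup) simp
  moreover have "b = \<one>\<^bsub>complex_units\<^esub>" if "(\<one>, b) \<in> ?S" for b
    using that ord unfolding S by auto
  ultimately obtain \<chi> where \<chi>: "\<chi> \<in> hom G complex_units" "\<And>x a. (x, a) \<in> ?S \<Longrightarrow> \<chi> x = a"
    by (rule divisible_extension[OF comm_group_complex_units divisible_complex_units, of ?S]) blast+
  have "(g, a) \<in> ?S"
    unfolding S using g by (intro range_eqI[of _ _ 1]) simp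
  with \<chi> show thesis using that by blast
qed

text \<open>An element of infinite order, encoded as \<open>ord x = 0\<close>, may be sent to any
  nonzero number, here \<open>2\<close>. One of finite order is sent to a primitive root of unity of
  that order.\<close>

lemma (in comm_group) characters_separate_points:
  assumes x: "x \<in> carrier G" "x \<noteq> \<one>"
  obtains \<chi> where "\<chi> \<in> hom G complex_units" "\<chi> x \<noteq> 1"
proof (cases "ord x = 0")
  case True
  have "2 powi k = (1::complex)" if "x [^] k = \<one>" for k :: int
    using that True x by (simp add: int_pow_eq_id)
  with x obtain \<chi> where "\<chi> \<in> hom G complex_units" "\<chi> x = 2"
    using character_extending_cyclic[of x 2] by auto
  with that show ?thesis by auto
next
  case False
  then have "0 < ord x" by simp
  define \<omega> where "\<omega> = cis (2 * pi / real (ord x))"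
  have \<omega>: "\<omega> \<noteq> 0" "\<omega> powi k = 1 \<longleftrightarrow> int (ord x) dvd k" for k :: int
    using cis_root_of_unity(1)[OF \<open>0 < ord x\<close>] by (simp_all add: \<omega>_def)
  with x obtain \<chi> where \<chi>: "\<chi> \<in> hom G complex_units" "\<chi> x = \<omega>"
    using character_extending_cyclic[of x \<omega>] by (auto simp: int_pow_eq_id)
  have "\<omega> powi 1 \<noteq> 1"
    using x ord_eq_1 by (subst \<omega>(2)) auto
  with \<chi> that show ?thesis by simp
qed

section \<open>The exponent of a finite abelian group\<close>

text \<open>In \<open>aux\<close>, raising \<open>(u \<otimes> v) [^] n\<close> to the power
  \<open>ord v\<close> removes \<open>v\<close>, so \<open>ord u\<close> divides
  \<open>n * ord v\<close> and, by coprimality, \<open>n\<close>. Swapping the roles shows that both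
  orders divide \<open>n\<close>.\<close>

lemma (in comm_group) ord_mult_coprime:
  assumes x: "x \<in> carrier G" and y: "y \<in> carrier G" and co: "coprime (ord x) (ord y)"
  shows "ord (x \<otimes> y) = ord x * ord y"
proof -
  have aux: "ord u dvd n" if "u \<in> carrier G" "v \<in> carrier G" "coprime (ord u) (ord v)" "(u \<otimes> v) [^] n = \<one>"
    for u v n
  proof -
    have "\<one> = (u \<otimes> v) [^] (n * ord v)"
      using that by (simp flip: nat_pow_pow)
    also have "\<dots> = u [^] (n * ord v) \<otimes> v [^] (ord v * n)"
      using that by (simp add: nat_pow_distrib mult.commute)
    also have "v [^] (ord v * n) = \<one>"
      using that by (simp flip: nat_pow_pow)
    finally have "ord u dvd n * ord v"
      using that by (simp flip: pow_eq_id)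
    then show ?thesis
      using that by (simp add: coprime_dvd_mult_left_iff)
  qed
  have "(x \<otimes> y) [^] n = \<one> \<longleftrightarrow> ord x * ord y dvd n" for n
  proof
    assume "(x \<otimes> y) [^] n = \<one>"
    then show "ord x * ord y dvd n"
      using aux[of x y n] aux[of y x n] x y co
      by (simp add: divides_mult m_comm coprime_commute)
  next
    assume "ord x * ord y dvd n"
    then have "ord x dvd n" "ord y dvd n"
      by (auto elim: dvd_mult_left dvd_mult_right)
    then show "(x \<otimes> y) [^] n = \<one>"
      using x y by (simp add: nat_pow_distrib flip: pow_eq_id)
  qed
  then show ?thesis
    using x y by (simp add: ord_unique)
qed

text \<open>An element \<open>g\<close> of largest order works. If \<open>ord h\<close> did not
  divide \<open>ord g\<close>, some prime \<open>p\<close> would occur to a higher power in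
  \<open>ord h\<close>, and exchanging the \<open>p\<close>-part of \<open>g\<close> for that of
  \<open>h\<close> would give an element of larger order.\<close>

lemma (in comm_group) exponent_attained:
  assumes fin: "finite (carrier G)"
  obtains g where "g \<in> carrier G" "\<And>h. h \<in> carrier G \<Longrightarrow> ord h dvd ord g"
proof -
  have "Max (ord ` carrier G) \<in> ord ` carrier G"
    using fin by (intro Max_in) auto
  then obtain g where g: "g \<in> carrier G" "ord g = Max (ord ` carrier G)" by auto
  have max: "ord h \<le> ord g" if "h \<in> carrier G" for h
    using that fin g(2) by simp
  have pos: "0 < ord h" if "h \<in> carrier G" for h
    using ord_ge_1[OF fin that] by simp
  show thesis
  proof
    fix h assume h: "h \<in> carrier G"
    show "ord h dvd ord g"
    proof (rule ccontr)
      assume "\<not> ord h dvd ord g"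
      then have "\<not> (\<forall>p. prime p \<longrightarrow> multiplicity p (ord h) \<le> multiplicity p (ord g))"
        using pos[OF h] by (intro notI) (simp add: multiplicity_le_imp_dvd)
      then obtain p where p: "prime p" "multiplicity p (ord g) < multiplicity p (ord h)"
        by (auto simp: not_le)
      define b where "b = multiplicity p (ord g)"
      define a where "a = multiplicity p (ord h)"
      have "p ^ a dvd ord h" "p ^ b dvd ord g"
        by (simp_all add: a_def b_def multiplicity_dvd)
      then obtain m n where m: "ord h = p ^ a * m" and n: "ord g = p ^ b * n" by (auto elim!: dvdE)
      have mn: "0 < m" "0 < n"
        using pos[OF h] pos[OF g(1)] m n by simp_all
      have "\<not> p dvd n"
      proof
        assume "p dvd n"
        then have "p ^ Suc b dvd ord g" by (auto simp: n)
        with pos[OF g(1)] p(1) have "Suc b \<le> b"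
          unfolding b_def by (subst (asm) power_dvd_iff_le_multiplicity) auto
        then show False by simp
      qed
      then have co: "coprime (p ^ a) n"
        using p(1) by (simp add: prime_imp_coprime)
      have "ord (h [^] m) = p ^ a"
        using h m mn by (simp add: ord_pow)
      moreover have "ord (g [^] (p ^ b)) = n"
        using g(1) n p(1) by (simp add: ord_pow prime_gt_0_nat)
      ultimately have "ord (h [^] m \<otimes> g [^] (p ^ b)) = p ^ a * n"
        using ord_mult_coprime[of "h [^] m" "g [^] (p ^ b)"] h g(1) co by simp
      then have "p ^ a * n \<le> p ^ b * n"
        using max[of "h [^] m \<otimes> g [^] (p ^ b)"] h g(1) n by simp
      then have "a \<le> b"
        using mn power_le_imp_le_exp[OF prime_gt_1_nat[OF p(1)]] by simp
      with p(2) show False by (simp add: a_def b_def)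
    qed
  qed (use g in simp)
qed


section \<open>Self-duality of finite abelian groups\<close>

text \<open>A perfect pairing identifies \<open>G\<close> with its group of characters.\<close>

definition perfect_pairing :: "('a, 'm) monoid_scheme \<Rightarrow> ('a \<Rightarrow> 'a \<Rightarrow> complex) \<Rightarrow> bool" where
  "perfect_pairing G \<beta> \<longleftrightarrow>
    (\<forall>x\<in>carrier G. \<beta> x \<in> hom G complex_units) \<and>
    (\<forall>x\<in>carrier G. \<forall>x'\<in>carrier G. \<forall>y\<in>carrier G. \<beta> (x \<otimes>\<^bsub>G\<^esub> x') y = \<beta> x y * \<beta> x' y) \<and>
    (\<forall>x\<in>carrier G. (\<forall>y\<in>carrier G. \<beta> x y = 1) \<longrightarrow> x = \<one>\<^bsub>G\<^esub>) \<and>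
    (\<forall>\<chi>\<in>hom G complex_units. \<exists>x\<in>carrier G. \<forall>y\<in>carrier G. \<chi> y = \<beta> x y)"

text \<open>A character \<open>\<chi>\<close> mapping an element \<open>g\<close> of maximal order \<open>n\<close> to a primitive \<open>n\<close>-th root of
  unity splits \<open>G\<close> as \<open>\<langle>g\<rangle> \<times> ker \<chi>\<close>; the pairing is the orthogonal sum of the standard pairing on
  \<open>\<langle>g\<rangle>\<close> and the one on \<open>ker \<chi>\<close> given by induction.\<close>

lemma (in comm_group) subgroup_comm_group:
  assumes "subgroup K G"
  shows "comm_group (G\<lparr>carrier := K\<rparr>)"
proof -
  interpret K: group "G\<lparr>carrier := K\<rparr>"
    using assms is_group by (rule subgroup.subgroup_is_group)
  show ?thesis
    by (rule K.group_comm_groupI) (use subgroup.mem_carrier[OF assms] in \<open>simp add: m_comm\<close>)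
qed

lemma (in comm_group) perfect_pairing_step:
  assumes fin: "finite (carrier G)"
    and IH: "\<And>K. subgroup K G \<Longrightarrow> K \<subset> carrier G \<Longrightarrow> \<exists>\<beta>. perfect_pairing (G\<lparr>carrier := K\<rparr>) \<beta>"
  shows "\<exists>\<beta>. perfect_pairing G \<beta>"
proof -
  note hom = hom_complex_unitsD[OF is_group]
  obtain g where g: "g \<in> carrier G" "\<And>h. h \<in> carrier G \<Longrightarrow> ord h dvd ord g"
    using exponent_attained[OF fin] by blast
  define n where "n = ord g"
  have n: "0 < n"
    using ord_ge_1[OF fin g(1)] by (simp add: n_def)
  have g_pow: "g [^] k = \<one> \<longleftrightarrow> int n dvd k" for k :: int
    using g(1) by (simp add: int_pow_eq_id n_def)
  define \<omega> where "\<omega> = cis (2 * pi / real n)"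
  have \<omega>: "\<omega> \<noteq> 0" "\<omega> powi k = 1 \<longleftrightarrow> int n dvd k" "z ^ n = 1 \<Longrightarrow> \<exists>k::int. z = \<omega> powi k"
    for k :: int and z
    using cis_root_of_unity[OF n] by (simp_all add: \<omega>_def)
  \<comment> \<open>By the choice of \<open>g\<close>, every \<open>x\<close> satisfies
    \<open>x [^] n = \<one>\<close>.\<close>
  have roots: "\<exists>k::int. \<psi> x = \<omega> powi k" if "\<psi> \<in> hom G complex_units" "x \<in> carrier G" for \<psi> x
  proof (rule \<omega>(3))
    have "x [^] int n = \<one>"
      using g(2)[OF that(2)] that(2) by (simp add: int_pow_eq_id n_def)
    then have "\<psi> x powi int n = 1"
      using hom(3,4)[OF that(1)] that(2) by metis
    then show "\<psi> x ^ n = 1" by simp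
  qed
  show ?thesis
  proof (cases "n = 1")
    case True
    have triv: "x = \<one>" if "x \<in> carrier G" for x
      using g(2)[OF that] True that by (simp add: n_def ord_eq_1[symmetric])
    have "perfect_pairing G (\<lambda>x y. 1)"
      unfolding perfect_pairing_def
    proof (intro conjI ballI)
      fix \<chi> assume "\<chi> \<in> hom G complex_units"
      then show "\<exists>x\<in>carrier G. \<forall>y\<in>carrier G. \<chi> y = 1"
        using hom(3) triv by (intro bexI[of _ \<one>]) auto
    qed (use triv in \<open>auto simp: hom_def\<close>)
    then show ?thesis by blast
  next
    case False
    obtain \<chi> where \<chi>: "\<chi> \<in> hom G complex_units" "\<chi> g = \<omega>"
      using character_extending_cyclic[OF g(1) \<omega>(1)] g_pow \<omega>(2) by blast
    note hom\<chi> = hom[OF \<chi>(1)]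
    define K where "K = {x \<in> carrier G. \<chi> x = 1}"
    have K: "subgroup K G"
      by (rule subgroupI) (use hom\<chi> in \<open>auto simp: K_def\<close>)
    let ?K = "G\<lparr>carrier := K\<rparr>"
    interpret K: comm_group ?K
      by (rule subgroup_comm_group[OF K])
    have "g \<notin> K"
      using \<omega>(2)[of 1] False n \<chi>(2) by (simp add: K_def)
    then have "K \<subset> carrier G"
      using g(1) by (auto simp: K_def)
    with K obtain \<beta> where \<beta>: "perfect_pairing ?K \<beta>"
      using IH by blast
    \<comment> \<open>\<open>e\<close> is a discrete logarithm to the base \<open>\<omega>\<close>,
      determined only modulo \<open>n\<close>, so it need not be additive.\<close>
    define e where "e x = (SOME k::int. \<chi> x = \<omega> powi k)" for x
    have e: "\<chi> x = \<omega> powi e x" if "x \<in> carrier G" for x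
      unfolding e_def by (rule someI_ex) (rule roots[OF \<chi>(1) that])
    \<comment> \<open>The projection onto \<open>K\<close> along the powers of
      \<open>g\<close>.\<close>
    define p where "p x = x \<otimes> g [^] (- e x)" for x
    have \<chi>_gpow: "\<chi> (g [^] k) = \<omega> powi k" for k :: int
      using hom\<chi>(4) g(1) \<chi>(2) by simp
    have p_carrier: "p x \<in> carrier G" if "x \<in> carrier G" for x
      using that g(1) by (simp add: p_def)
    have p_K: "p x \<in> K" if "x \<in> carrier G" for x
    proof -
      have "\<chi> (p x) = \<chi> x * \<chi> (g [^] (- e x))"
        unfolding p_def using that g(1) by (intro hom\<chi>(2)) auto
      also have "\<dots> = 1"
        using e[OF that] \<omega>(1) by (simp add: \<chi>_gpow power_int_minus)
      finally show ?thesis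
        using p_carrier[OF that] by (simp add: K_def)
    qed
    have decomp: "x = g [^] e x \<otimes> p x" if "x \<in> carrier G" for x
      using that g(1) by (simp add: p_def m_lcomm int_pow_neg)
    \<comment> \<open>\<open>g\<close> and \<open>\<omega>\<close> both have order \<open>n\<close>,
      so exponents are ambiguous to the same extent for both.\<close>
    have mod_n: "g [^] k = g [^] l \<longleftrightarrow> \<omega> powi k = \<omega> powi l" for k l :: int
    proof -
      have "\<omega> powi k = \<omega> powi l \<longleftrightarrow> \<omega> powi (l - k) = 1"
        using \<omega>(1) by (auto simp: power_int_diff)
      then show ?thesis
        using \<omega>(2) g(1) by (simp add: int_pow_eq n_def)
    qed
    \<comment> \<open>Uniqueness of the decomposition into a power of \<open>g\<close> and an
      element of \<open>K\<close>; it makes \<open>p\<close> multiplicative.\<close>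
    have p_unique: "p (g [^] k \<otimes> b) = b \<and> \<chi> (g [^] k \<otimes> b) = \<omega> powi k" if "b \<in> K" for k :: int and b
    proof -
      have b: "b \<in> carrier G" "\<chi> b = 1" using that by (auto simp: K_def)
      then have \<chi>: "\<chi> (g [^] k \<otimes> b) = \<omega> powi k"
        using g(1) by (simp add: hom\<chi>(2) \<chi>_gpow)
      then have "g [^] e (g [^] k \<otimes> b) = g [^] k"
        using e[of "g [^] k \<otimes> b"] b g(1) by (simp add: mod_n)
      then have "g [^] k \<otimes> p (g [^] k \<otimes> b) = g [^] k \<otimes> b"
        using decomp[of "g [^] k \<otimes> b"] b g(1) by simp
      then have "p (g [^] k \<otimes> b) = b"
        using b g(1) p_carrier by simp
      with \<chi> show ?thesis by simp
    qed
    have p_mult: "p (x \<otimes> y) = p x \<otimes> p y" if "x \<in> carrier G" "y \<in> carrier G" for x y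
    proof -
      have "x \<otimes> y = (g [^] e x \<otimes> p x) \<otimes> (g [^] e y \<otimes> p y)"
        using decomp that by metis
      also have "\<dots> = g [^] (e x + e y) \<otimes> (p x \<otimes> p y)"
        using that g(1) p_carrier by (simp add: int_pow_mult[symmetric] m_ac)
      finally show ?thesis
        using p_unique[of "p x \<otimes> p y" "e x + e y"] p_K that subgroup.m_closed[OF K] by metis
    qed
    have \<beta>_hom: "\<beta> b \<in> hom ?K complex_units" if "b \<in> K" for b
      using \<beta> that by (simp add: perfect_pairing_def)
    note hom\<beta> = hom_complex_unitsD[OF K.is_group \<beta>_hom]
    \<comment> \<open>The first factor is \<open>\<omega>\<close> to the power
      \<open>e x * e y\<close>. Written with \<open>\<chi> y\<close> it is multiplicative in
      \<open>y\<close>, and in the form \<open>\<gamma>_alt\<close> it is multiplicative in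
      \<open>x\<close>; this avoids additivity of \<open>e\<close>.\<close>
    define \<gamma> where "\<gamma> x y = \<chi> y powi e x * \<beta> (p x) (p y)" for x y
    have \<gamma>_alt: "\<gamma> x y = \<chi> x powi e y * \<beta> (p x) (p y)" if "x \<in> carrier G" "y \<in> carrier G" for x y
      using that by (simp add: \<gamma>_def e mult.commute flip: power_int_mult)
    have "perfect_pairing G \<gamma>"
      unfolding perfect_pairing_def
    proof (intro conjI ballI impI)
      fix x assume x: "x \<in> carrier G"
      show "\<gamma> x \<in> hom G complex_units"
      proof (rule homI)
        fix y assume y: "y \<in> carrier G"
        show "\<gamma> x y \<in> carrier complex_units"
          using hom\<chi>(1)[OF y] hom\<beta>(1)[OF p_K[OF x]] p_K[OF y] by (simp add: \<gamma>_def)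
        fix z assume z: "z \<in> carrier G"
        show "\<gamma> x (y \<otimes> z) = \<gamma> x y \<otimes>\<^bsub>complex_units\<^esub> \<gamma> x z"
          using hom\<beta>(2)[OF p_K[OF x], of "p y" "p z"] p_K y z
          by (simp add: \<gamma>_def hom\<chi>(2) p_mult power_int_mult_distrib)
      qed
    next
      fix x x' y assume x: "x \<in> carrier G" "x' \<in> carrier G" and y: "y \<in> carrier G"
      have "\<beta> (p x \<otimes> p x') (p y) = \<beta> (p x) (p y) * \<beta> (p x') (p y)"
        using \<beta> x y p_K by (simp add: perfect_pairing_def)
      with x y show "\<gamma> (x \<otimes> x') y = \<gamma> x y * \<gamma> x' y"
        by (simp add: \<gamma>_alt p_mult hom\<chi>(2) power_int_mult_distrib)
    next
      fix x assume x: "x \<in> carrier G" and triv: "\<forall>y\<in>carrier G. \<gamma> x y = 1"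
      \<comment> \<open>Pairing with \<open>g\<close> shows that the power of \<open>g\<close> in
        \<open>x\<close> is trivial. Then \<open>x\<close> lies in \<open>K\<close>, where
        \<open>\<beta>\<close> is nondegenerate.\<close>
      have "p g = \<one>"
        using p_unique[of \<one> 1] g(1) subgroup.one_closed[OF K] by simp
      then have "\<omega> powi e x * \<beta> (p x) \<one> = 1"
        using bspec[OF triv g(1)] \<chi>(2) by (simp add: \<gamma>_def)
      then have "\<omega> powi e x = \<omega> powi 0"
        using hom\<beta>(3)[OF p_K[OF x]] by simp
      then have "g [^] e x = \<one>"
        using mod_n[of "e x" 0] by simp
      then have px: "p x = x"
        using decomp[OF x] p_carrier[OF x] by simp
      have "\<beta> x y = 1" if "y \<in> K" for y
        using triv that p_unique[OF that, of 0] px by (auto simp: \<gamma>_def K_def)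
      then show "x = \<one>"
        using \<beta> p_K[OF x] px by (simp add: perfect_pairing_def)
    next
      fix \<psi> assume \<psi>: "\<psi> \<in> hom G complex_units"
      note hom\<psi> = hom[OF \<psi>]
      \<comment> \<open>The representing element is \<open>g [^] k \<otimes> b\<close>:
        \<open>k\<close> is read off from \<open>\<psi> g\<close>, and \<open>b\<close> represents
        the restriction of \<open>\<psi>\<close> to \<open>K\<close>.\<close>
      obtain k :: int where k: "\<psi> g = \<omega> powi k"
        using roots[OF \<psi> g(1)] by blast
      have "\<psi> \<in> hom ?K complex_units"
        using \<psi> by (auto simp: hom_def K_def)
      then obtain b where b: "b \<in> K" "\<And>y. y \<in> K \<Longrightarrow> \<psi> y = \<beta> b y"
        using \<beta> by (auto simp: perfect_pairing_def)
      show "\<exists>x\<in>carrier G. \<forall>y\<in>carrier G. \<psi> y = \<gamma> x y"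
      proof (intro bexI ballI)
        show x: "g [^] k \<otimes> b \<in> carrier G"
          using b(1) g(1) by (simp add: K_def)
        fix y assume y: "y \<in> carrier G"
        have "\<psi> y = \<psi> (g [^] e y) * \<psi> (p y)"
          using decomp[OF y] hom\<psi>(2)[of "g [^] e y" "p y"] g(1) p_carrier[OF y] by simp
        also have "\<psi> (g [^] e y) = (\<omega> powi k) powi e y"
          using hom\<psi>(4) g(1) k by simp
        also have "\<psi> (p y) = \<beta> b (p y)"
          using b(2) p_K[OF y] .
        finally show "\<psi> y = \<gamma> (g [^] k \<otimes> b) y"
          using \<gamma>_alt[OF x y] p_unique[OF b(1), of k] by simp
      qed
    qed
    then show ?thesis by blast
  qed
qed

theorem perfect_pairing_exists:
  assumes "comm_group G" "finite (carrier G)"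
  shows "\<exists>\<beta>. perfect_pairing G \<beta>"
  using assms
proof (induction "card (carrier G)" arbitrary: G rule: less_induct)
  case (less G)
  interpret comm_group G by fact
  show ?case
  proof (rule perfect_pairing_step[OF less.prems(2)])
    fix K assume K: "subgroup K G" "K \<subset> carrier G"
    show "\<exists>\<beta>. perfect_pairing (G\<lparr>carrier := K\<rparr>) \<beta>"
      using K less.prems(2)
      by (intro less.hyps subgroup_comm_group) (auto intro: psubset_card_mono finite_subset)
  qed
qed

section \<open>Groups with finitely many characters\<close>

text \<open>Powers of a character are characters, so by pigeonhole two of them agree and the values
  are roots of unity of a fixed order. As characters separate points, evaluating at all of them
  embeds \<open>G\<close> into a finite product of finite sets.\<close>

lemma (in comm_group) finite_if_finitely_many_characters:
  assumes X: "finite X"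
    and chars: "\<And>\<chi>. \<chi> \<in> hom G complex_units \<Longrightarrow> \<exists>\<xi>\<in>X. \<forall>x\<in>carrier G. \<chi> x = \<xi> x"
  shows "finite (carrier G)"
proof -
  have tors: "\<exists>N>0. \<forall>x\<in>carrier G. \<chi> x ^ N = 1" if \<chi>: "\<chi> \<in> hom G complex_units" for \<chi>
  proof -
    note hom = hom_complex_unitsD[OF is_group \<chi>]
    have "(\<lambda>x. \<chi> x ^ k) \<in> hom G complex_units" for k
      by (rule homI) (simp_all add: hom power_mult_distrib)
    then have "\<forall>k. \<exists>\<xi>\<in>X. \<forall>x\<in>carrier G. \<chi> x ^ k = \<xi> x"
      using chars by blast
    then obtain \<xi> where \<xi>: "\<And>k. \<xi> k \<in> X" "\<And>k x. x \<in> carrier G \<Longrightarrow> \<chi> x ^ k = \<xi> k x"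
      by metis
    have "finite (range \<xi>)"
      using X \<xi>(1) by (auto intro: finite_subset)
    then have "\<not> inj \<xi>"
      using finite_imageD infinite_UNIV_nat by blast
    then obtain j k where "\<xi> j = \<xi> k" "j < k"
      by (metis injI linorder_neqE_nat)
    have "\<chi> x ^ (k - j) = 1" if x: "x \<in> carrier G" for x
    proof -
      have "\<chi> x ^ k = \<chi> x ^ j"
        using \<xi>(2)[OF x] \<open>\<xi> j = \<xi> k\<close> by simp
      then show ?thesis
        using hom(1)[OF x] \<open>j < k\<close> by (simp add: power_diff)
    qed
    with \<open>j < k\<close> show ?thesis
      by (intro exI[of _ "k - j"]) simp
  qed
  \<comment> \<open>\<open>X\<close> may contain functions that are not characters; those kept have
    values in the roots of unity of some fixed order.\<close>
  define Y where "Y = {\<xi> \<in> X. \<exists>N>0. \<forall>x\<in>carrier G. \<xi> x ^ N = 1}"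
  define N where "N \<xi> = (SOME N::nat. 0 < N \<and> (\<forall>x\<in>carrier G. \<xi> x ^ N = 1))" for \<xi> :: "'a \<Rightarrow> complex"
  have N: "0 < N \<xi>" "\<And>x. x \<in> carrier G \<Longrightarrow> \<xi> x ^ N \<xi> = 1" if "\<xi> \<in> Y" for \<xi>
    using that someI_ex[of "\<lambda>N. 0 < N \<and> (\<forall>x\<in>carrier G. \<xi> x ^ N = 1)"]
    by (auto simp: Y_def N_def)
  have Y: "\<exists>\<xi>\<in>Y. \<forall>x\<in>carrier G. \<chi> x = \<xi> x" if \<chi>: "\<chi> \<in> hom G complex_units" for \<chi>
  proof -
    obtain \<xi> where "\<xi> \<in> X" "\<forall>x\<in>carrier G. \<chi> x = \<xi> x"
      using chars[OF \<chi>] by blast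
    then show ?thesis
      using tors[OF \<chi>] by (intro bexI[of _ \<xi>]) (auto simp: Y_def)
  qed
  define F where "F x = (\<lambda>\<xi>\<in>Y. \<xi> x)" for x
  have "F ` carrier G \<subseteq> (\<Pi>\<^sub>E \<xi>\<in>Y. {z. z ^ N \<xi> = 1})"
    unfolding F_def by (intro image_subsetI) (simp add: restrict_PiE_iff N(2))
  moreover have "finite (\<Pi>\<^sub>E \<xi>\<in>Y. {z::complex. z ^ N \<xi> = 1})"
    using X N(1) by (intro finite_PiE finite_nth_roots) (auto simp: Y_def)
  ultimately have "finite (F ` carrier G)"
    by (rule finite_subset)
  moreover have "inj_on F (carrier G)"
  proof (rule inj_onI)
    fix x y assume x: "x \<in> carrier G" and y: "y \<in> carrier G" and eq: "F x = F y"
    have "\<chi> (x \<otimes> inv y) = 1" if \<chi>: "\<chi> \<in> hom G complex_units" for \<chi>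
    proof -
      obtain \<xi> where \<xi>: "\<xi> \<in> Y" "\<forall>x\<in>carrier G. \<chi> x = \<xi> x"
        using Y[OF \<chi>] by blast
      then have "\<chi> x = \<chi> y"
        using x y fun_cong[OF eq, of \<xi>] by (simp add: F_def)
      then show ?thesis
        using hom_complex_unitsD[OF is_group \<chi>] x y by simp
    qed
    then have "x \<otimes> inv y = \<one>"
      using characters_separate_points[of "x \<otimes> inv y"] x y by (metis inv_closed m_closed)
    then show "x = y"
      using x y by (metis inv_equality inv_closed inv_inv)
  qed
  ultimately show ?thesis
    by (rule finite_imageD)
qed

text \<open>The group \<open>\<complex>\<^sup>*\<close> written additively, with zero bracket, so that the universal property
  \<^const>\<open>free_lift\<close> applies to maps into it.\<close>

typedef cunit = "{z::complex. z \<noteq> 0}"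
  morphisms complex_of_cunit cunit_of_complex
  by (intro exI[of _ 1]) simp

setup_lifting type_definition_cunit

instantiation cunit :: lie_ring
begin

lift_definition zero_cunit :: cunit is 1 by simp
lift_definition plus_cunit :: "cunit \<Rightarrow> cunit \<Rightarrow> cunit" is "(*)" by simp
lift_definition uminus_cunit :: "cunit \<Rightarrow> cunit" is inverse by simp
lift_definition minus_cunit :: "cunit \<Rightarrow> cunit \<Rightarrow> cunit" is "(/)" by simp
definition bracket_cunit :: "cunit \<Rightarrow> cunit \<Rightarrow> cunit" where "bracket_cunit a b = 0"

instance
proof
  fix a b c :: cunit
  show "a + b + c = a + (b + c)" by transfer simp
  show "a + b = b + a" by transfer simp
  show "0 + a = a" by transfer simp
  show "- a + a = 0" by transfer simp
  show "a - b = a + - b" by transfer (simp add: divide_inverse)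
  have "(0 :: cunit) = 0 + 0" by transfer simp
  then show "bracket (a + b) c = bracket a c + bracket b c"
    and "bracket a (b + c) = bracket a b + bracket a c"
    and "bracket a (bracket b c) + bracket b (bracket c a) + bracket c (bracket a b) = 0"
    by (simp_all add: bracket_cunit_def)
qed (rule bracket_cunit_def)

end

lemma complex_of_cunit_nonzero [simp]: "complex_of_cunit a \<noteq> 0"
  using complex_of_cunit[of a] by simp

lemma complex_of_cunit_eq_1_iff [simp]: "complex_of_cunit a = 1 \<longleftrightarrow> a = 0"
  by transfer simp

lemma cunit_of_complex_inverse_nonzero [simp]: "z \<noteq> 0 \<Longrightarrow> complex_of_cunit (cunit_of_complex z) = z"
  by (simp add: cunit_of_complex_inverse)

lemma cunit_of_complex_hom:
  "w \<noteq> 0 \<Longrightarrow> z \<noteq> 0 \<Longrightarrow> cunit_of_complex (w * z) = cunit_of_complex w + cunit_of_complex z"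
  "z \<noteq> 0 \<Longrightarrow> cunit_of_complex (inverse z) = - cunit_of_complex z"
  "cunit_of_complex 1 = 0"
  by (simp_all add: complex_of_cunit_inject[symmetric] plus_cunit.rep_eq uminus_cunit.rep_eq zero_cunit.rep_eq)

lemma lie_hom_cunit_lie_square:
  assumes "lie_hom (h :: 'a::lie_ring \<Rightarrow> cunit)" "a \<in> lie_square"
  shows "h a = 0"
  using assms(2)[unfolded lie_square_def]
proof induction
  case (lie_subring_gen_base s)
  then show ?case using assms(1) by (auto simp: lie_hom_def bracket_cunit_def)
next
  case (lie_subring_gen_bracket a b)
  then show ?case using assms(1) by (simp add: lie_hom_def bracket_cunit_def)
qed (use assms(1) in \<open>simp_all add: lie_hom_zero lie_hom_minus\<close>, simp add: lie_hom_def)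

section \<open>Free Lie rings and their abelianizations\<close>

lemma free_lie_induct [case_names gen zero add uminus bracket]:
  assumes "\<And>x. P (free_gen x)" "P 0" "\<And>u v. P u \<Longrightarrow> P v \<Longrightarrow> P (u + v)" "\<And>u. P u \<Longrightarrow> P (- u)"
    "\<And>u v. P u \<Longrightarrow> P v \<Longrightarrow> P (bracket u v)"
  shows "P w"
proof -
  have "P (abs_free_lie t)" for t
    by (induction t)
      (use assms in \<open>simp_all add: free_gen.abs_eq zero_free_lie_def
        flip: plus_free_lie.abs_eq uminus_free_lie.abs_eq bracket_free_lie.abs_eq\<close>)
  then show ?thesis
    by (metis Quotient_free_lie Quotient_abs_rep)
qed

text \<open>\<open>p\<close> and \<open>q\<close> need not be additive; it is enough that their
  defects of additivity agree. The defects determine the values at \<open>0\<close> and at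
  \<open>- u\<close> as well.\<close>

lemma free_lie_fun_eqI:
  fixes p q :: "'x free_lie \<Rightarrow> 'b::ab_group_add"
  assumes gen: "\<And>x. p (free_gen x) = q (free_gen x)"
    and add: "\<And>u v. p (u + v) - p u - p v = q (u + v) - q u - q v"
    and br: "\<And>u v. p (bracket u v) = q (bracket u v)"
  shows "p w = q w"
proof -
  have zero: "p 0 = q 0"
    using add[of 0 0] by simp
  show ?thesis
  proof (induction w rule: free_lie_induct)
    case (add u v)
    then show ?case using assms(2)[of u v] by simp
  next
    case (uminus u)
    then show ?case using add[of u "- u"] zero by simp
  qed (use gen br zero in auto)
qed

section \<open>Identities of the free Lie ring comonad\<close>

lemma free_counit_gen [simp]: "free_counit (free_gen x) = x"
  and free_map_gen [simp]: "free_map k (free_gen y) = free_gen (k y)"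
  by (simp_all add: free_counit_def free_map_def free_lift_gen)

lemma lie_hom_free_counit: "lie_hom free_counit"
  and lie_hom_free_map: "lie_hom (free_map k)"
  by (simp_all add: free_counit_def free_map_def free_lift_hom)

lemma lie_homD:
  "lie_hom h \<Longrightarrow> h (x + y) = h x + h y"
  "lie_hom h \<Longrightarrow> h (bracket x y) = bracket (h x) (h y)"
  by (simp_all add: lie_hom_def)

lemmas free_hom_simps [simp] =
  lie_homD[OF lie_hom_free_counit] lie_homD[OF lie_hom_free_map] lie_homD[OF free_lift_hom]
  lie_hom_zero[OF lie_hom_free_counit] lie_hom_zero[OF lie_hom_free_map]

declare free_lift_gen [simp]

text \<open>Naturality of the counit, applied to the counit itself.\<close>

lemma free_counit_free_map_counit: "free_counit (free_map free_counit W) = free_counit (free_counit W)"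
  by (induction W rule: free_lie_induct)
    (simp_all add: lie_hom_minus[OF lie_hom_free_counit] lie_hom_minus[OF lie_hom_free_map])

text \<open>One triangle identity of the free/forgetful adjunction. The next lemma is the free
  functor applied to the other one.\<close>

lemma free_counit_free_map_gen: "free_counit (free_map free_gen w) = w"
  by (induction w rule: free_lie_induct)
    (simp_all add: lie_hom_minus[OF lie_hom_free_counit] lie_hom_minus[OF lie_hom_free_map])

lemma free_map_counit_free_map_gen: "free_map free_counit (free_map free_gen w) = w"
  by (induction w rule: free_lie_induct) (simp_all add: lie_hom_minus[OF lie_hom_free_map])

section \<open>Additive maps on abelianizations\<close>

lemma additive_ab_class: "additive ab_class"
  by unfold_locales (simp add: plus_abelianization.abs_eq)

lemmas ab_class_simps [simp] =
  additive.zero[OF additive_ab_class] additive.add[OF additive_ab_class]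

lemma ab_class_bracket [simp]: "ab_class (bracket x y) = 0"
  using ab_class_eq_iff[of "bracket x y" 0] by (simp add: lie_square_bracket)

lemma ab_class_cases:
  obtains x where "X = ab_class x"
  by (metis Quotient_abelianization Quotient_abs_rep)

lemma additive_ab_map:
  fixes h :: "'a::lie_ring \<Rightarrow> 'b::lie_ring"
  assumes "lie_hom h"
  shows "additive (ab_map h)"
proof
  fix X Y :: "'a abelianization"
  obtain x where "X = ab_class x" by (rule ab_class_cases)
  moreover obtain y where "Y = ab_class y" by (rule ab_class_cases)
  ultimately show "ab_map h (X + Y) = ab_map h X + ab_map h Y"
    using ab_map_ab_class[OF assms] lie_homD(1)[OF assms] ab_class_simps(2) by metis
qed

text \<open>Brackets have class \<open>0\<close>, so an additive map on the abelianization is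
  decided by its values on generators.\<close>

lemma free_ab_eqI:
  fixes p q :: "'x free_lie abelianization \<Rightarrow> 'b::ab_group_add"
  assumes p: "additive p" and q: "additive q"
    and gen: "\<And>x. p (ab_class (free_gen x)) = q (ab_class (free_gen x))"
  shows "p = q"
proof
  fix X :: "'x free_lie abelianization"
  obtain w where X: "X = ab_class w" by (rule ab_class_cases)
  have "p (ab_class w) = q (ab_class w)"
    by (rule free_lie_fun_eqI) (simp_all add: gen additive.add[OF p] additive.add[OF q]
        additive.zero[OF p] additive.zero[OF q])
  with X show "p X = q X" by simp
qed

text \<open>The abelianization of the free Lie ring on \<open>X\<close> is the free abelian group on \<open>X\<close>:\<close>

definition ab_extend :: "('x \<Rightarrow> cunit) \<Rightarrow> 'x free_lie abelianization \<Rightarrow> cunit" where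
  "ab_extend h X = free_lift h (rep_abelianization X)"

text \<open>The bracket of \<open>cunit\<close> is zero, so \<open>free_lift h\<close> kills
  \<open>lie_square\<close> and the representative chosen in \<open>ab_extend\<close> does not
  matter.\<close>

lemma ab_extend_ab_class: "ab_extend h (ab_class w) = free_lift h w"
proof -
  have "rep_abelianization (ab_class w) - w \<in> lie_square"
    using Quotient_abs_rep[OF Quotient_abelianization] ab_class_eq_iff by blast
  then have "free_lift h (rep_abelianization (ab_class w) - w) = 0"
    by (rule lie_hom_cunit_lie_square[OF free_lift_hom])
  then show ?thesis
    by (simp add: ab_extend_def lie_hom_diff[OF free_lift_hom])
qed

lemma ab_extend_gen [simp]: "ab_extend h (ab_class (free_gen x)) = h x"
  by (simp add: ab_extend_ab_class)

lemma additive_ab_extend: "additive (ab_extend (h :: 'x \<Rightarrow> cunit))"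
proof
  fix X Y :: "'x free_lie abelianization"
  obtain x where "X = ab_class x" by (rule ab_class_cases)
  moreover obtain y where "Y = ab_class y" by (rule ab_class_cases)
  ultimately show "ab_extend h (X + Y) = ab_extend h X + ab_extend h Y"
    by (simp add: ab_extend_ab_class flip: ab_class_simps(2))
qed

lemma ab_extend_add: "ab_extend (\<lambda>x. h x + k x) = (\<lambda>X. ab_extend h X + ab_extend k X)"
  by (rule free_ab_eqI) (auto intro!: additive.intro simp: additive.add[OF additive_ab_extend])

lemma additive_minus_fun: "additive p \<Longrightarrow> additive q \<Longrightarrow> additive (\<lambda>x. p x - q x)"
  and additive_comp: "additive p \<Longrightarrow> additive r \<Longrightarrow> additive (\<lambda>x. p (r x))"
  by (auto simp: additive_def)

section \<open>Faces of the resolution\<close>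

lemma lie_hom_res_face: "lie_hom (res_face1 i)" "lie_hom (res_face2 i)"
  by (simp_all add: res_face1_def res_face2_def lie_hom_free_counit lie_hom_free_map)

lemmas additive_ab_face1 = additive_ab_map[OF lie_hom_res_face(1)]
  and additive_ab_face2 = additive_ab_map[OF lie_hom_res_face(2)]

text \<open>On a basis element, face \<open>0\<close> strips the outer generator, while the other
  faces keep it and change its label.\<close>

lemma ab_face_gen [simp]:
  "ab_map (res_face1 0) (ab_class (free_gen w)) = ab_class w"
  "ab_map (res_face1 (Suc 0)) (ab_class (free_gen w)) = ab_class (free_gen (free_counit w))"
  "ab_map (res_face2 0) (ab_class (free_gen W)) = ab_class W"
  "ab_map (res_face2 (Suc 0)) (ab_class (free_gen W)) = ab_class (free_gen (free_counit W))"
  "ab_map (res_face2 (Suc (Suc 0))) (ab_class (free_gen W)) = ab_class (free_gen (free_map free_counit W))"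
  by (simp_all add: ab_map_ab_class[OF lie_hom_res_face(1)] ab_map_ab_class[OF lie_hom_res_face(2)])
    (simp_all add: res_face1_def res_face2_def)


section \<open>Cocycles\<close>

text \<open>The additively written counterpart of \<open>lie_Z2\<close>;
  \<open>complex_fun_in_lie_Z2_iff\<close> matches the two for \<open>complex_units\<close>.\<close>

locale lie_cocycle =
  fixes f g :: "'l::lie_ring \<Rightarrow> 'l \<Rightarrow> 'c::ab_group_add"
  assumes f_add_left: "f (x + y) z = f x z + f y z + g (bracket x z) (bracket y z)"
    and f_add_right: "f x (y + z) = f x y + f x z + g (bracket x y) (bracket x z)"
    and f_self: "f x x = 0"
    and f_jacobi: "f x (bracket y z) + f z (bracket x y) + f y (bracket z x) =
      - g (bracket x (bracket y z)) (bracket z (bracket x y))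
      - g (- bracket y (bracket z x)) (bracket y (bracket z x))"
    and g_assoc: "g (x + y) z + g x y = g x (y + z) + g y z"
    and g_commute: "g x y = g y x"

text \<open>The universal property of the free Lie ring, applied to the extension of \<open>L\<close> by \<open>C\<close> with
  cocycle \<open>(f, g)\<close>: the homomorphism from the free Lie ring on \<open>L\<close> to the extension \<open>C \<times> L\<close>
  with \<open>x \<mapsto> (0, x)\<close> is \<open>w \<mapsto> (cocycle_map f g w, free_counit w)\<close>.\<close>

primrec cocycle_term :: "('l::lie_ring \<Rightarrow> 'l \<Rightarrow> 'c::ab_group_add) \<Rightarrow> ('l \<Rightarrow> 'l \<Rightarrow> 'c) \<Rightarrow> 'l lie_term \<Rightarrow> 'c"
where
  "cocycle_term f g (TGen x) = 0"
| "cocycle_term f g TZero = 0"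
| "cocycle_term f g (TAdd s t) =
    cocycle_term f g s + cocycle_term f g t + g (eval_lie_term id s) (eval_lie_term id t)"
| "cocycle_term f g (TNeg s) = - cocycle_term f g s - g (- eval_lie_term id s) (eval_lie_term id s)"
| "cocycle_term f g (TBracket s t) = f (eval_lie_term id s) (eval_lie_term id t)"

definition cocycle_map :: "('l::lie_ring \<Rightarrow> 'l \<Rightarrow> 'c::ab_group_add) \<Rightarrow> ('l \<Rightarrow> 'l \<Rightarrow> 'c) \<Rightarrow> 'l free_lie \<Rightarrow> 'c"
  where "cocycle_map f g w = cocycle_term f g (rep_free_lie w)"

lemma eval_lie_term_id: "eval_lie_term id t = free_counit (abs_free_lie t)"
  by (simp add: free_counit_def free_lift.abs_eq)

lemma eval_lie_term_lie_eq: "lie_eq s t \<Longrightarrow> eval_lie_term id s = eval_lie_term id t"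
  by (metis eval_lie_term_id free_lie.abs_eq_iff)

section \<open>The map on the free Lie ring attached to a cocycle\<close>

context lie_cocycle
begin

text \<open>\<open>f_add_left\<close> and \<open>f_self\<close> at \<open>0\<close> give
  \<open>g 0 0 = 0\<close>; \<open>g_assoc\<close> and symmetry carry this to all
  \<open>x\<close>.\<close>

lemma g_zero [simp]: "g 0 x = 0" "g x 0 = 0"
proof -
  have "g 0 0 = 0"
    using f_add_left[of 0 0 0] f_self[of 0] by (simp add: bracket_self)
  then show "g 0 x = 0"
    using g_assoc[of 0 0 x] by simp
  then show "g x 0 = 0"
    by (simp add: g_commute)
qed

text \<open>The two sides are the defects of adding \<open>x\<close>, \<open>y\<close>,
  \<open>z\<close> in two orders. \<open>f_jacobi\<close> groups the Jacobi terms differently from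
  \<open>lie_eq_jacobi\<close>, and this identity converts one grouping into the other.\<close>

lemma g_triple: "g x y + g (x + y) z = g x z + g (x + z) y"
  using g_assoc[of x y z] g_assoc[of x z y] g_commute[of y z]
  by (simp add: algebra_simps)

text \<open>Each Lie ring law holds in the extension thanks to the cocycle conditions; this makes
  \<open>cocycle_map\<close> independent of the representing term.\<close>

lemma cocycle_term_lie_eq: "lie_eq s t \<Longrightarrow> cocycle_term f g s = cocycle_term f g t"
proof (induction rule: lie_eq.induct)
  case (lie_eq_add_assoc s t u)
  show ?case
    using g_assoc[of "eval_lie_term id s" "eval_lie_term id t" "eval_lie_term id u"]
    by (simp add: algebra_simps)
next
  case (lie_eq_add_comm s t)
  show ?case by (simp add: g_commute)
next
  case (lie_eq_bracket_self s)
  show ?case by (simp add: f_self)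
next
  case (lie_eq_jacobi s t u)
  let ?x = "eval_lie_term id s" and ?y = "eval_lie_term id t" and ?z = "eval_lie_term id u"
  let ?a = "bracket ?x (bracket ?y ?z)" and ?b = "bracket ?y (bracket ?z ?x)" and ?c = "bracket ?z (bracket ?x ?y)"
  have "?a + ?c = - ?b"
    using jacobi[of ?x ?y ?z] by (simp add: algebra_simps eq_neg_iff_add_eq_0)
  then have "g ?a ?b + g (?a + ?b) ?c = g ?a ?c + g (- ?b) ?b"
    using g_triple[of ?a ?b ?c] by simp
  moreover have "f ?x (bracket ?y ?z) + f ?z (bracket ?x ?y) + f ?y (bracket ?z ?x) + (g ?a ?c + g (- ?b) ?b) = 0"
    using f_jacobi[of ?x ?y ?z] by simp
  ultimately have "(f ?x (bracket ?y ?z) + f ?y (bracket ?z ?x) + g ?a ?b) + f ?z (bracket ?x ?y) + g (?a + ?b) ?c = 0"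
    by (simp only: add.assoc add.commute add.left_commute)
  then show ?case by simp
qed (simp_all add: eval_lie_term_lie_eq f_add_left f_add_right)

lemma cocycle_map_abs: "cocycle_map f g (abs_free_lie t) = cocycle_term f g t"
  unfolding cocycle_map_def
  by (rule cocycle_term_lie_eq) (simp add: Quotient3_rep_abs[OF Quotient3_free_lie] lie_eq_refl)

lemma cocycle_map_gen [simp]: "cocycle_map f g (free_gen x) = 0"
  by (simp add: free_gen.abs_eq cocycle_map_abs)

lemma cocycle_map_add [simp]:
  "cocycle_map f g (u + v) = cocycle_map f g u + cocycle_map f g v + g (free_counit u) (free_counit v)"
proof -
  obtain s t where "u = abs_free_lie s" "v = abs_free_lie t"
    by (metis Quotient_free_lie Quotient_abs_rep)
  then show ?thesis
    by (simp add: plus_free_lie.abs_eq cocycle_map_abs flip: eval_lie_term_id)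
qed

lemma cocycle_map_bracket [simp]:
  "cocycle_map f g (bracket u v) = f (free_counit u) (free_counit v)"
proof -
  obtain s t where "u = abs_free_lie s" "v = abs_free_lie t"
    by (metis Quotient_free_lie Quotient_abs_rep)
  then show ?thesis
    by (simp add: bracket_free_lie.abs_eq cocycle_map_abs flip: eval_lie_term_id)
qed

lemma cocycle_map_eqI:
  assumes "\<And>x. p (free_gen x) = 0"
    and "\<And>u v. p (u + v) = p u + p v + g (free_counit u) (free_counit v)"
    and "\<And>u v. p (bracket u v) = f (free_counit u) (free_counit v)"
  shows "cocycle_map f g w = p w"
  by (rule free_lie_fun_eqI) (simp_all add: assms)

end

section \<open>The character of a cocycle on degree one of the resolution\<close>

definition cocycle_char :: "('l::lie_ring \<Rightarrow> 'l \<Rightarrow> cunit) \<Rightarrow> ('l \<Rightarrow> 'l \<Rightarrow> cunit) \<Rightarrow> 'l res1 abelianization \<Rightarrow> cunit"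
  where "cocycle_char f g = ab_extend (cocycle_map f g)"

lemma additive_cocycle_char: "additive (cocycle_char f g)"
  by (simp add: cocycle_char_def additive_ab_extend)

lemma cocycle_char_gen [simp]: "cocycle_char f g (ab_class (free_gen w)) = cocycle_map f g w"
  by (simp add: cocycle_char_def)

lemma lie_cocycle_add:
  assumes "lie_cocycle f g" "lie_cocycle f' g'"
  shows "lie_cocycle (\<lambda>x y. f x y + f' x y) (\<lambda>x y. g x y + g' x y)"
proof -
  interpret A: lie_cocycle f g by fact
  interpret B: lie_cocycle f' g' by fact
  show ?thesis
  proof
    fix x y z
    show "f x (bracket y z) + f' x (bracket y z) + (f z (bracket x y) + f' z (bracket x y)) +
        (f y (bracket z x) + f' y (bracket z x)) =
      - (g (bracket x (bracket y z)) (bracket z (bracket x y)) + g' (bracket x (bracket y z)) (bracket z (bracket x y)))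
      - (g (- bracket y (bracket z x)) (bracket y (bracket z x)) + g' (- bracket y (bracket z x)) (bracket y (bracket z x)))"
      using A.f_jacobi[of x y z] B.f_jacobi[of x y z] by (simp add: algebra_simps)
    show "g (x + y) z + g' (x + y) z + (g x y + g' x y) = g x (y + z) + g' x (y + z) + (g y z + g' y z)"
      using A.g_assoc[of x y z] B.g_assoc[of x y z] by (simp add: algebra_simps)
    show "g x y + g' x y = g y x + g' y x"
      by (simp add: A.g_commute B.g_commute)
  qed (simp_all add: A.f_add_left A.f_add_right A.f_self B.f_add_left B.f_add_right B.f_self ac_simps)
qed

lemma lie_cocycle_uminus:
  assumes "lie_cocycle f g"
  shows "lie_cocycle (\<lambda>x y. - f x y) (\<lambda>x y. - g x y)"
proof -
  interpret lie_cocycle f g by fact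
  show ?thesis
  proof
    fix x y z
    show "- f x (bracket y z) + - f z (bracket x y) + - f y (bracket z x) =
      - (- g (bracket x (bracket y z)) (bracket z (bracket x y)))
      - (- g (- bracket y (bracket z x)) (bracket y (bracket z x)))"
      using arg_cong[OF f_jacobi[of x y z], of uminus] by (simp add: algebra_simps)
    show "- g (x + y) z + - g x y = - g x (y + z) + - g y z"
      using arg_cong[OF g_assoc[of x y z], of uminus] by (simp add: algebra_simps)
    show "- g x y = - g y x"
      by (simp add: g_commute)
  qed (simp_all add: f_add_left f_add_right f_self)
qed

lemma lie_cocycle_zero: "lie_cocycle (\<lambda>x y. 0) (\<lambda>x y. 0)"
  by unfold_locales simp_all

lemma cocycle_char_add:
  assumes "lie_cocycle f g" "lie_cocycle f' g'"
  shows "cocycle_char (\<lambda>x y. f x y + f' x y) (\<lambda>x y. g x y + g' x y) = (\<lambda>X. cocycle_char f g X + cocycle_char f' g' X)"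
proof -
  interpret A: lie_cocycle f g by fact
  interpret B: lie_cocycle f' g' by fact
  interpret AB: lie_cocycle "\<lambda>x y. f x y + f' x y" "\<lambda>x y. g x y + g' x y"
    by (rule lie_cocycle_add) fact+
  have "cocycle_map (\<lambda>x y. f x y + f' x y) (\<lambda>x y. g x y + g' x y) = (\<lambda>w. cocycle_map f g w + cocycle_map f' g' w)"
    by (rule ext, rule AB.cocycle_map_eqI) simp_all
  then show ?thesis
    by (simp add: cocycle_char_def ab_extend_add)
qed

text \<open>On a basis element labelled \<open>W\<close> this relates three functions of
  \<open>W\<close> built from \<open>cocycle_map f g\<close>. By naturality of the counit both sides
  have the same defect of additivity and the same values on brackets. It forces the character to
  vanish on boundaries.\<close>

lemma cocycle_char_boundary:
  assumes "lie_cocycle f g"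
  shows "(\<lambda>Y. cocycle_char f g (ab_map (res_face2 (Suc (Suc 0))) Y)) =
    (\<lambda>Y. cocycle_char f g (ab_map (res_face2 (Suc 0)) Y) - cocycle_char f g (ab_map (res_face2 0) Y))"
proof (rule free_ab_eqI)
  interpret lie_cocycle f g by fact
  show "additive (\<lambda>Y. cocycle_char f g (ab_map (res_face2 (Suc (Suc 0))) Y))"
    "additive (\<lambda>Y. cocycle_char f g (ab_map (res_face2 (Suc 0)) Y) - cocycle_char f g (ab_map (res_face2 0) Y))"
    by (intro additive_minus_fun additive_comp[OF additive_cocycle_char additive_ab_face2])+
  fix W
  have "cocycle_map f g (free_counit W) =
      cocycle_map f g (free_map free_counit W) + free_lift (cocycle_map f g) W"
    by (rule free_lie_fun_eqI) (simp_all add: free_counit_free_map_counit bracket_cunit_def)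
  then show "cocycle_char f g (ab_map (res_face2 (Suc (Suc 0))) (ab_class (free_gen W))) =
      cocycle_char f g (ab_map (res_face2 (Suc 0)) (ab_class (free_gen W))) -
      cocycle_char f g (ab_map (res_face2 0) (ab_class (free_gen W)))"
    by (simp add: cocycle_char_def ab_extend_ab_class)
qed

lemma coboundary_cocycle:
  fixes t :: "'l::lie_ring \<Rightarrow> cunit"
  assumes t: "t 0 = 0"
  shows "lie_cocycle (\<lambda>x y. - t (bracket x y)) (\<lambda>x y. t x + t y - t (x + y))"
proof
  fix x y z :: 'l
  have "bracket x (bracket y z) + bracket z (bracket x y) = - bracket y (bracket z x)"
    using jacobi[of x y z] by (simp add: algebra_simps eq_neg_iff_add_eq_0)
  then show "- t (bracket x (bracket y z)) + - t (bracket z (bracket x y)) + - t (bracket y (bracket z x)) =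
    - (t (bracket x (bracket y z)) + t (bracket z (bracket x y)) - t (bracket x (bracket y z) + bracket z (bracket x y)))
    - (t (- bracket y (bracket z x)) + t (bracket y (bracket z x)) - t (- bracket y (bracket z x) + bracket y (bracket z x)))"
    by (simp add: t algebra_simps)
qed (simp_all add: t bracket_add_left bracket_add_right bracket_self algebra_simps)

text \<open>The cocycle map of the coboundary of \<open>t\<close> is
  \<open>free_lift t w - t (free_counit w)\<close>, and its two terms are \<open>t\<close> extended
  along faces \<open>0\<close> and \<open>1\<close>. Hence the character vanishes on cycles.\<close>

lemma cocycle_char_coboundary:
  assumes t: "t 0 = 0"
  shows "cocycle_char (\<lambda>x y. - t (bracket x y)) (\<lambda>x y. t x + t y - t (x + y)) =
    (\<lambda>X. ab_extend t (ab_map (res_face1 0) X) - ab_extend t (ab_map (res_face1 (Suc 0)) X))"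
proof (rule free_ab_eqI)
  interpret lie_cocycle "\<lambda>x y. - t (bracket x y)" "\<lambda>x y. t x + t y - t (x + y)"
    using t by (rule coboundary_cocycle)
  show "additive (\<lambda>X. ab_extend t (ab_map (res_face1 0) X) - ab_extend t (ab_map (res_face1 (Suc 0)) X))"
    by (intro additive_minus_fun additive_comp[OF additive_ab_extend additive_ab_face1])
  fix w
  have "cocycle_map (\<lambda>x y. - t (bracket x y)) (\<lambda>x y. t x + t y - t (x + y)) w = free_lift t w - t (free_counit w)"
    by (rule cocycle_map_eqI) (simp_all add: bracket_cunit_def)
  then show "cocycle_char (\<lambda>x y. - t (bracket x y)) (\<lambda>x y. t x + t y - t (x + y)) (ab_class (free_gen w)) =
     ab_extend t (ab_map (res_face1 0) (ab_class (free_gen w))) -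
     ab_extend t (ab_map (res_face1 (Suc 0)) (ab_class (free_gen w)))"
    by (simp add: ab_extend_ab_class)
qed (rule additive_cocycle_char)

section \<open>Cycles, boundaries and characters of cocycles\<close>

definition add_group :: "'a::ab_group_add monoid" where
  "add_group = \<lparr>carrier = UNIV, monoid.mult = (+), one = 0\<rparr>"

lemma add_group_simps [simp]:
  "carrier add_group = UNIV" "x \<otimes>\<^bsub>add_group\<^esub> y = x + y" "\<one>\<^bsub>add_group\<^esub> = 0"
  by (simp_all add: add_group_def)

lemma comm_group_add_group: "comm_group (add_group :: 'a::ab_group_add monoid)"
  by (rule comm_groupI) (auto simp: add_ac intro: exI[of _ "- x" for x])

lemma inv_add_group [simp]: "inv\<^bsub>add_group\<^esub> x = - x"
proof -
  interpret comm_group "add_group :: 'a monoid" by (rule comm_group_add_group)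
  show ?thesis by (rule inv_equality) simp_all
qed

text \<open>By \<open>ker\<close>, the pairs \<open>(d x, \<Phi> x)\<close> with \<open>x\<close> in
  \<open>Z\<close> form the graph of a homomorphism on the image of \<open>Z\<close>, which extends
  by divisibility. With \<open>d\<close> the identity this extends \<open>\<Phi>\<close> from
  \<open>Z\<close> to the whole group.\<close>

lemma additive_factor:
  fixes d :: "'q::ab_group_add \<Rightarrow> 'p::ab_group_add" and \<Phi> :: "'q \<Rightarrow> cunit"
  assumes Z: "0 \<in> Z" "\<And>x y. x \<in> Z \<Longrightarrow> y \<in> Z \<Longrightarrow> x + y \<in> Z" "\<And>x. x \<in> Z \<Longrightarrow> - x \<in> Z"
    and \<Phi>: "\<And>x y. x \<in> Z \<Longrightarrow> y \<in> Z \<Longrightarrow> \<Phi> (x + y) = \<Phi> x + \<Phi> y"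
    and d: "additive d"
    and ker: "\<And>x. x \<in> Z \<Longrightarrow> d x = 0 \<Longrightarrow> \<Phi> x = 0"
  obtains \<chi> where "additive \<chi>" "\<And>x. x \<in> Z \<Longrightarrow> \<chi> (d x) = \<Phi> x"
proof -
  interpret P: comm_group "add_group :: 'p monoid" by (rule comm_group_add_group)
  interpret PC: group "(add_group :: 'p monoid) \<times>\<times> complex_units"
    by (rule DirProd_group) (rule P.is_group complex_units.is_group)+
  define S where "S = {(d x, complex_of_cunit (\<Phi> x)) |x. x \<in> Z}"
  have \<Phi>0: "\<Phi> 0 = 0"
    using \<Phi>[of 0 0] Z(1) by simp
  have \<Phi>m: "\<Phi> (- x) = - \<Phi> x" if "x \<in> Z" for x
    using \<Phi>[of x "- x"] Z(3) that \<Phi>0 by (simp add: eq_neg_iff_add_eq_0 add.commute)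
  have "subgroup S (add_group \<times>\<times> complex_units)"
  proof (rule PC.subgroupI)
    show "S \<subseteq> carrier (add_group \<times>\<times> complex_units)" "S \<noteq> {}"
      using Z(1) by (auto simp: S_def)
  next
    fix a assume "a \<in> S"
    then obtain x where "x \<in> Z" "a = (d x, complex_of_cunit (\<Phi> x))"
      by (auto simp: S_def)
    then show "inv\<^bsub>add_group \<times>\<times> complex_units\<^esub> a \<in> S"
      using Z(3)[of x] \<Phi>m[of x]
      by (auto simp: S_def inv_DirProd[OF P.is_group complex_units.is_group] additive.minus[OF d]
          uminus_cunit.rep_eq intro!: exI[of _ "- x"])
  next
    fix a b assume "a \<in> S" "b \<in> S"
    then obtain x y where "x \<in> Z" "a = (d x, complex_of_cunit (\<Phi> x))"
      "y \<in> Z" "b = (d y, complex_of_cunit (\<Phi> y))"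
      by (auto simp: S_def)
    then show "a \<otimes>\<^bsub>add_group \<times>\<times> complex_units\<^esub> b \<in> S"
      using Z(2)[of x y] \<Phi>[of x y]
      by (auto simp: S_def additive.add[OF d] plus_cunit.rep_eq intro!: exI[of _ "x + y"])
  qed
  moreover have "a = \<one>\<^bsub>complex_units\<^esub>" if "(\<one>\<^bsub>add_group\<^esub>, a) \<in> S" for a
    using that ker by (auto simp: S_def)
  ultimately obtain \<chi> where \<chi>: "\<chi> \<in> hom add_group complex_units" "\<And>x a. (x, a) \<in> S \<Longrightarrow> \<chi> x = a"
    by (rule P.divisible_extension[OF comm_group_complex_units divisible_complex_units, of S]) blast+
  note hom = hom_complex_unitsD[OF P.is_group \<chi>(1), simplified]
  show thesis
  proof
    show "additive (\<lambda>x. cunit_of_complex (\<chi> x))"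
      by unfold_locales (simp add: hom cunit_of_complex_hom)
    show "cunit_of_complex (\<chi> (d x)) = \<Phi> x" if "x \<in> Z" for x
    proof -
      have "(d x, complex_of_cunit (\<Phi> x)) \<in> S"
        unfolding S_def using that by blast
      then show ?thesis
        using \<chi>(2) by (simp add: complex_of_cunit_inverse)
    qed
  qed
qed

text \<open>\<open>\<Phi>\<close> factors through the pair of maps into the product type, and an
  additive map on a product splits into its two components.\<close>

lemma additive_factor_pair:
  fixes d :: "'q::ab_group_add \<Rightarrow> 'p::ab_group_add" and d' :: "'q \<Rightarrow> 'r::ab_group_add" and \<Phi> :: "'q \<Rightarrow> cunit"
  assumes \<Phi>: "additive \<Phi>" and d: "additive d" and d': "additive d'"
    and ker: "\<And>x. d x = 0 \<Longrightarrow> d' x = 0 \<Longrightarrow> \<Phi> x = 0"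
  obtains T T' where "additive T" "additive T'" "\<And>x. \<Phi> x = T (d x) + T' (d' x)"
proof -
  have "additive (\<lambda>x. (d x, d' x))"
    using d d' by (simp add: additive_def)
  then obtain \<chi> :: "'p \<times> 'r \<Rightarrow> cunit" where \<chi>: "additive \<chi>" "\<And>x. \<chi> (d x, d' x) = \<Phi> x"
    using additive_factor[of UNIV \<Phi> "\<lambda>x. (d x, d' x)"] ker additive.add[OF \<Phi>]
    by (auto simp: zero_prod_def)
  show thesis
  proof
    show "additive (\<lambda>a. \<chi> (a, 0))" "additive (\<lambda>b. \<chi> (0, b))"
      using \<chi>(1) by (simp_all add: additive_def flip: \<chi>(1)[unfolded additive_def, rule_format])
    show "\<Phi> x = \<chi> (d x, 0) + \<chi> (0, d' x)" for x
      by (simp add: \<chi>(2) flip: additive.add[OF \<chi>(1)])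
  qed
qed

section \<open>Cycles and boundaries in degree one\<close>

definition res_cycles :: "'l::lie_ring res1 abelianization set" where
  "res_cycles = {x. ab_map (res_face1 0) x = 0 \<and> ab_map (res_face1 (Suc 0)) x = 0}"

definition res_boundaries :: "'l::lie_ring res1 abelianization set" where
  "res_boundaries = {ab_map (res_face2 (Suc (Suc 0))) y |y.
    ab_map (res_face2 0) y = 0 \<and> ab_map (res_face2 (Suc 0)) y = 0}"

lemma res_cycles_closed:
  "0 \<in> res_cycles" "x \<in> res_cycles \<Longrightarrow> y \<in> res_cycles \<Longrightarrow> x + y \<in> res_cycles"
  "x \<in> res_cycles \<Longrightarrow> - x \<in> res_cycles"
  by (simp_all add: res_cycles_def additive.zero[OF additive_ab_face1]
      additive.add[OF additive_ab_face1] additive.minus[OF additive_ab_face1])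

text \<open>The simplicial identities \<open>d\<^sub>0 d\<^sub>2 = d\<^sub>1 d\<^sub>0\<close> and
  \<open>d\<^sub>1 d\<^sub>2 = d\<^sub>1 d\<^sub>1\<close>, checked on basis elements.\<close>

lemma res_boundaries_subset_cycles: "(res_boundaries :: 'a::lie_ring res1 abelianization set) \<subseteq> res_cycles"
proof -
  have face: "ab_map (res_face1 (Suc 0)) (ab_class W) = ab_class (free_map free_counit W)"
    for W :: "'a free_lie free_lie"
    unfolding ab_map_ab_class[OF lie_hom_res_face(1)] by (simp add: res_face1_def)
  have "(\<lambda>y :: 'a res2 abelianization. ab_map (res_face1 0) (ab_map (res_face2 (Suc (Suc 0))) y)) =
      (\<lambda>y :: 'a res2 abelianization. ab_map (res_face1 (Suc 0)) (ab_map (res_face2 0) y))"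
    by (rule free_ab_eqI)
      (auto intro: additive_comp[OF additive_ab_face1 additive_ab_face2]
        simp: face)
  moreover have "(\<lambda>y :: 'a res2 abelianization. ab_map (res_face1 (Suc 0)) (ab_map (res_face2 (Suc (Suc 0))) y)) =
      (\<lambda>y :: 'a res2 abelianization. ab_map (res_face1 (Suc 0)) (ab_map (res_face2 (Suc 0)) y))"
    by (rule free_ab_eqI)
      (auto intro: additive_comp[OF additive_ab_face1 additive_ab_face2] simp: free_counit_free_map_counit)
  ultimately show ?thesis
    unfolding fun_eq_iff
    by (auto simp: res_boundaries_def res_cycles_def additive.zero[OF additive_ab_face1])
qed

lemma cocycle_char_res_boundaries:
  assumes "lie_cocycle f g" "x \<in> res_boundaries"
  shows "cocycle_char f g x = 0"
  using assms(2) fun_cong[OF cocycle_char_boundary[OF assms(1)]]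
  by (auto simp: res_boundaries_def additive.zero[OF additive_cocycle_char])

lemma cocycle_char_coboundary_res_cycles:
  assumes "t 0 = 0" "x \<in> res_cycles"
  shows "cocycle_char (\<lambda>x y. - t (bracket x y)) (\<lambda>x y. t x + t y - t (x + y)) x = 0"
  using assms by (simp add: cocycle_char_coboundary res_cycles_def additive.zero[OF additive_ab_extend])

lemma (in lie_cocycle) cocycle_map_zero [simp]: "cocycle_map f g 0 = 0"
  using cocycle_map_add[of 0 0] by simp

section \<open>Injectivity and surjectivity of the passage from cocycle classes to
  characters\<close>

text \<open>A character trivial on cycles factors through faces \<open>0\<close> and
  \<open>1\<close>. Evaluating this factorization on brackets and sums of two generators exhibits
  \<open>f\<close> and \<open>g\<close> as a coboundary.\<close>

lemma cocycle_char_eq_zero_imp_coboundary: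
  fixes f g :: "'l::lie_ring \<Rightarrow> 'l \<Rightarrow> cunit"
  assumes "lie_cocycle f g" and zero: "\<And>x. x \<in> res_cycles \<Longrightarrow> cocycle_char f g x = 0"
  shows "\<exists>t. t 0 = 0 \<and> f = (\<lambda>x y. - t (bracket x y)) \<and> g = (\<lambda>x y. t x + t y - t (x + y))"
proof -
  interpret lie_cocycle f g by fact
  obtain T T' where T: "additive T" "additive T'"
    and eq: "\<And>x. cocycle_char f g x = T (ab_map (res_face1 0) x) + T' (ab_map (res_face1 (Suc 0)) x)"
    by (rule additive_factor_pair[of "cocycle_char f g" "ab_map (res_face1 0)" "ab_map (res_face1 (Suc 0))"])
      (use zero in \<open>auto simp: res_cycles_def additive_cocycle_char additive_ab_face1\<close>)
  \<comment> \<open>The sign is chosen so that \<open>T\<close> takes the value \<open>t x\<close>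
    on the generator \<open>x\<close>: the cocycle map vanishes there.\<close>
  define t where "t x = - T' (ab_class (free_gen x))" for x
  have map: "cocycle_map f g w = T (ab_class w) - t (free_counit w)" for w
    using eq[of "ab_class (free_gen w)"] by (simp add: t_def)
  have gen: "T (ab_class (free_gen x)) = t x" for x
    using map[of "free_gen x"] by simp
  show ?thesis
  proof (intro exI conjI)
    show "t 0 = 0"
      using map[of 0] by (simp add: additive.zero[OF T(1)])
    show "f = (\<lambda>x y. - t (bracket x y))"
    proof (intro ext)
      show "f x y = - t (bracket x y)" for x y
        using map[of "bracket (free_gen x) (free_gen y)"] by (simp add: additive.zero[OF T(1)])
    qed
    show "g = (\<lambda>x y. t x + t y - t (x + y))"
    proof (intro ext)
      show "g x y = t x + t y - t (x + y)" for x y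
        using map[of "free_gen x + free_gen y"] by (simp add: additive.add[OF T(1)] gen)
    qed
  qed
qed

text \<open>\<open>\<Psi>\<close> is extended to all of degree one and normalized. That it kills
  boundaries yields a function \<open>s\<close> on the free Lie ring whose defect of additivity and
  values on brackets depend only on counits; these are the cocycle.\<close>

lemma cocycle_char_surj:
  fixes \<Psi> :: "'l::lie_ring res1 abelianization \<Rightarrow> cunit"
  assumes add: "\<And>x y. x \<in> res_cycles \<Longrightarrow> y \<in> res_cycles \<Longrightarrow> \<Psi> (x + y) = \<Psi> x + \<Psi> y"
    and zero: "\<And>x. x \<in> res_boundaries \<Longrightarrow> \<Psi> x = 0"
  obtains f g where "lie_cocycle f g" "\<And>x. x \<in> res_cycles \<Longrightarrow> \<Psi> x = cocycle_char f g x"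
proof -
  let ?d0 = "ab_map (res_face1 0) :: 'l res1 abelianization \<Rightarrow> _"
  let ?d1 = "ab_map (res_face1 (Suc 0)) :: 'l res1 abelianization \<Rightarrow> _"
  have \<Psi>0: "\<Psi> 0 = 0"
    using add[of 0 0] res_cycles_closed(1) by simp
  \<comment> \<open>\<open>additive_factor\<close> with the identity map extends
    \<open>\<Psi>\<close> beyond the cycles.\<close>
  obtain \<Psi>' where \<Psi>': "additive \<Psi>'" "\<And>x. x \<in> res_cycles \<Longrightarrow> \<Psi>' x = \<Psi> x"
    by (rule additive_factor[of res_cycles \<Psi> "\<lambda>x. x"])
      (use res_cycles_closed add \<Psi>0 in \<open>auto simp: additive_def\<close>)
  \<comment> \<open>The corrections factor through faces \<open>0\<close> and \<open>1\<close>, so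
    they vanish on cycles. They are chosen to make \<open>\<psi>\<close> below vanish at the
    generators and at \<open>0\<close>.\<close>
  define c where "c = \<Psi>' (ab_class (free_gen 0))"
  define t where "t x = \<Psi>' (ab_class (free_gen (free_gen x))) - c" for x
  define \<Theta> where "\<Theta> x = \<Psi>' x - ab_extend t (?d0 x) - ab_extend (\<lambda>_. c) (?d1 x)" for x
  have \<Theta>: "additive \<Theta>"
    unfolding \<Theta>_def
    by (intro additive_minus_fun \<Psi>'(1) additive_comp[OF additive_ab_extend additive_ab_face1])
  have \<Theta>_cycles: "\<Theta> x = \<Psi> x" if "x \<in> res_cycles" for x
    using that \<Psi>'(2)[OF that] by (simp add: \<Theta>_def res_cycles_def additive.zero[OF additive_ab_extend])
  define \<psi> where "\<psi> w = \<Theta> (ab_class (free_gen w))" for w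
  have \<psi>_gen: "\<psi> (free_gen x) = 0" for x
    by (simp add: \<psi>_def \<Theta>_def t_def)
  have \<psi>_zero: "\<psi> 0 = 0"
    by (simp add: \<psi>_def \<Theta>_def additive.zero[OF additive_ab_extend] flip: c_def)
  \<comment> \<open>If faces \<open>0\<close> and \<open>1\<close> of \<open>y\<close> vanish, face
    \<open>2\<close> is a boundary, on which \<open>\<Theta>\<close> is zero. Hence this composite
    factors through the first two faces.\<close>
  obtain S S' where S: "additive S" "additive S'"
    and eq: "\<And>y. \<Theta> (ab_map (res_face2 (Suc (Suc 0))) y) =
      S (ab_map (res_face2 0) y) + S' (ab_map (res_face2 (Suc 0)) y)"
  proof (rule additive_factor_pair[of "\<lambda>y. \<Theta> (ab_map (res_face2 (Suc (Suc 0))) y)"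
        "ab_map (res_face2 0)" "ab_map (res_face2 (Suc 0))"])
    show "additive (\<lambda>y. \<Theta> (ab_map (res_face2 (Suc (Suc 0))) y))"
      by (rule additive_comp[OF \<Theta> additive_ab_face2])
    fix y :: "'l res2 abelianization"
    assume "ab_map (res_face2 0) y = 0" "ab_map (res_face2 (Suc 0)) y = 0"
    then have "ab_map (res_face2 (Suc (Suc 0))) y \<in> res_boundaries"
      by (auto simp: res_boundaries_def)
    then show "\<Theta> (ab_map (res_face2 (Suc (Suc 0))) y) = 0"
      using \<Theta>_cycles zero res_boundaries_subset_cycles by auto
  qed (auto simp: additive_ab_face2)
  define s where "s w = S' (ab_class (free_gen w))" for w
  have \<psi>_map: "\<psi> (free_map free_counit W) = S (ab_class W) + s (free_counit W)" for W
    using eq[of "ab_class (free_gen W)"] by (simp add: \<psi>_def s_def)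
  have S_gen: "S (ab_class (free_gen w)) = - s w" for w
    using \<psi>_map[of "free_gen w"] by (simp add: \<psi>_gen eq_neg_iff_add_eq_0)
  \<comment> \<open>A map \<open>cocycle_map f g\<close> has exactly these values on brackets and
    sums of two generators.\<close>
  define f where "f x y = \<psi> (bracket (free_gen x) (free_gen y))" for x y
  define g where "g x y = \<psi> (free_gen x + free_gen y)" for x y
  have s_zero: "s 0 = 0"
    using \<psi>_map[of 0] by (simp add: \<psi>_zero additive.zero[OF S(1)])
  have s_add: "s (u + v) = s u + s v + g (free_counit u) (free_counit v)" for u v
    using \<psi>_map[of "free_gen u + free_gen v"] by (simp add: g_def additive.add[OF S(1)] S_gen algebra_simps)
  have s_bracket: "s (bracket u v) = f (free_counit u) (free_counit v)" for u v
    using \<psi>_map[of "bracket (free_gen u) (free_gen v)"] by (simp add: f_def additive.zero[OF S(1)])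
  \<comment> \<open>Each condition is an identity in the free Lie ring on \<open>L\<close>,
    evaluated under \<open>s\<close>, or under \<open>\<psi>\<close> for the symmetry of
    \<open>g\<close>.\<close>
  interpret lie_cocycle f g
  proof
    fix x y z :: 'l
    let ?x = "free_gen x" and ?y = "free_gen y" and ?z = "free_gen z"
    show "f (x + y) z = f x z + f y z + g (bracket x z) (bracket y z)"
      using s_bracket[of "?x + ?y" ?z] by (simp add: bracket_add_left s_add s_bracket)
    show "f x (y + z) = f x y + f x z + g (bracket x y) (bracket x z)"
      using s_bracket[of ?x "?y + ?z"] by (simp add: bracket_add_right s_add s_bracket)
    show "f x x = 0"
      using s_bracket[of ?x ?x] by (simp add: bracket_self s_zero)
    show "g x y = g y x"
      by (simp add: g_def add.commute)
    show "g (x + y) z + g x y = g x (y + z) + g y z"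
      using s_add[of "?x + ?y" ?z] s_add[of ?x "?y + ?z"] s_add[of ?x ?y] s_add[of ?y ?z]
      by (simp add: algebra_simps)
    let ?a = "bracket ?x (bracket ?y ?z)" and ?b = "bracket ?y (bracket ?z ?x)" and ?c = "bracket ?z (bracket ?x ?y)"
    have "?a + ?c = - ?b"
      using jacobi[of ?x ?y ?z] by (simp add: algebra_simps eq_neg_iff_add_eq_0)
    then have "s ?a + s ?c + g (free_counit ?a) (free_counit ?c) = s (- ?b)"
      using s_add[of ?a ?c] by simp
    moreover have "s (- ?b) + s ?b + g (- free_counit ?b) (free_counit ?b) = 0"
      using s_add[of "- ?b" ?b] s_zero by (simp add: lie_hom_minus[OF lie_hom_free_counit])
    ultimately have "(s ?a + s ?c + g (free_counit ?a) (free_counit ?c)) + s ?b + g (- free_counit ?b) (free_counit ?b) = 0"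
      by simp
    then have "(s ?a + s ?c + s ?b) + (g (free_counit ?a) (free_counit ?c) + g (- free_counit ?b) (free_counit ?b)) = 0"
      by (simp only: add.assoc add.commute add.left_commute)
    then have "s ?a + s ?c + s ?b = - (g (free_counit ?a) (free_counit ?c) + g (- free_counit ?b) (free_counit ?b))"
      by (simp only: eq_neg_iff_add_eq_0)
    then show "f x (bracket y z) + f z (bracket x y) + f y (bracket z x) =
      - g (bracket x (bracket y z)) (bracket z (bracket x y)) - g (- bracket y (bracket z x)) (bracket y (bracket z x))"
      by (simp add: s_bracket)
  qed
  \<comment> \<open>Subtracting the Lie homomorphism that agrees with \<open>s\<close> on generators
    makes \<open>s\<close> vanish there and leaves its defect and its values on brackets
    unchanged.\<close>
  have map: "cocycle_map f g w = s w - free_lift (\<lambda>x. s (free_gen x)) w" for w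
    by (rule cocycle_map_eqI) (simp_all add: s_add s_bracket bracket_cunit_def)
  have char: "cocycle_char f g = (\<lambda>x. S' x - ab_extend (\<lambda>x. s (free_gen x)) (?d0 x))"
    by (rule free_ab_eqI)
      (auto intro!: additive_minus_fun additive_cocycle_char S additive_comp[OF additive_ab_extend additive_ab_face1]
        simp: map ab_extend_ab_class s_def)
  \<comment> \<open>\<open>?J\<close> is induced by a degeneracy of the resolution. It is a section
    of faces \<open>1\<close> and \<open>2\<close>, and its face \<open>0\<close> factors through
    face \<open>0\<close>, which kills cycles. So \<open>eq\<close> at \<open>?J x\<close> becomes
    \<open>\<Theta> x = S' x\<close> for a cycle \<open>x\<close>.\<close>
  let ?J = "ab_map (free_map (free_map free_gen)) :: 'l res1 abelianization \<Rightarrow> 'l res2 abelianization"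
  have J: "additive ?J" and J0: "additive (ab_map (free_map free_gen))"
    by (rule additive_ab_map[OF lie_hom_free_map])+
  have J_gen: "?J (ab_class (free_gen w)) = ab_class (free_gen (free_map free_gen w))" for w
    by (simp add: ab_map_ab_class[OF lie_hom_free_map])
  have J_gen0: "ab_map (free_map free_gen) (ab_class w) = ab_class (free_map free_gen w)" for w :: "'l free_lie"
    by (simp add: ab_map_ab_class[OF lie_hom_free_map])
  have J2: "(\<lambda>x. ab_map (res_face2 (Suc (Suc 0))) (?J x)) = (\<lambda>x. x)"
    by (rule free_ab_eqI) (auto simp: J_gen additive_comp[OF additive_ab_face2 J]
        free_map_counit_free_map_gen intro: additive.intro)
  have J1: "(\<lambda>x. ab_map (res_face2 (Suc 0)) (?J x)) = (\<lambda>x. x)"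
    by (rule free_ab_eqI) (auto simp: J_gen additive_comp[OF additive_ab_face2 J]
        free_counit_free_map_gen intro: additive.intro)
  have J0_eq: "(\<lambda>x. ab_map (res_face2 0) (?J x)) = (\<lambda>x. ab_map (free_map free_gen) (?d0 x))"
    by (rule free_ab_eqI) (auto simp: J_gen J_gen0 additive_comp[OF additive_ab_face2 J]
        additive_comp[OF J0 additive_ab_face1])
  have "\<Psi> x = cocycle_char f g x" if "x \<in> res_cycles" for x
    using that eq[of "?J x"] fun_cong[OF J2, of x] fun_cong[OF J1, of x] fun_cong[OF J0_eq, of x] \<Theta>_cycles[OF that]
    by (simp add: char res_cycles_def additive.zero[OF S(1)] additive.zero[OF J0] additive.zero[OF additive_ab_extend])
  then show thesis
    using that lie_cocycle_axioms by blast
qed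

text \<open>Since \<open>Ext(L, \<complex>\<^sup>*) = 0\<close>, every cocycle is cohomologous to one with \<open>g = 0\<close>, and then \<open>f\<close> is
  biadditive.\<close>

lemma symmetric_cocycle_trivial:
  fixes f g :: "'l::lie_ring \<Rightarrow> 'l \<Rightarrow> cunit"
  assumes "lie_cocycle f g"
  obtains t where "t 0 = 0" "g = (\<lambda>x y. t x + t y - t (x + y))"
proof -
  interpret lie_cocycle f g by fact
  define Z :: "'l free_lie set" where "Z = {w. free_counit w = 0}"
  \<comment> \<open>On \<open>Z\<close> the cocycle map is additive because
    \<open>g 0 0 = 0\<close>, so it extends to the whole free Lie ring.\<close>
  obtain \<chi> where \<chi>: "additive \<chi>" "\<And>w. w \<in> Z \<Longrightarrow> \<chi> w = cocycle_map f g w"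
    by (rule additive_factor[of Z "cocycle_map f g" "\<lambda>w. w"])
      (auto simp: Z_def lie_hom_minus[OF lie_hom_free_counit] additive_def)
  define t where "t x = \<chi> (free_gen x)" for x
  have map: "cocycle_map f g w = \<chi> w - t (free_counit w)" for w
  proof -
    \<comment> \<open>Adding back the generator leaves the cocycle map unchanged: it is zero on
      generators, and \<open>g\<close> is zero when an argument is \<open>0\<close>.\<close>
    let ?v = "w - free_gen (free_counit w)"
    have v: "?v \<in> Z"
      by (simp add: Z_def lie_hom_diff[OF lie_hom_free_counit])
    have "cocycle_map f g (?v + free_gen (free_counit w)) = cocycle_map f g ?v"
      using v unfolding cocycle_map_add by (simp add: Z_def)
    then show ?thesis
      using \<chi>(2)[OF v] by (simp add: t_def additive.diff[OF \<chi>(1)])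
  qed
  show thesis
  proof
    show "t 0 = 0"
      using map[of 0] by (simp add: additive.zero[OF \<chi>(1)])
    show "g = (\<lambda>x y. t x + t y - t (x + y))"
    proof (intro ext)
      show "g x y = t x + t y - t (x + y)" for x y
        using map[of "free_gen x + free_gen y"] by (simp add: additive.add[OF \<chi>(1)] t_def)
    qed
  qed
qed

text \<open>Adding the coboundary of \<open>- t\<close>, with \<open>t\<close> from
  \<open>symmetric_cocycle_trivial\<close>, cancels \<open>g\<close> and preserves the character on
  cycles.\<close>

lemma cocycle_char_biadditive:
  fixes f g :: "'l::lie_ring \<Rightarrow> 'l \<Rightarrow> cunit"
  assumes "lie_cocycle f g"
  obtains h where "lie_cocycle h (\<lambda>x y. 0)" "\<And>x. x \<in> res_cycles \<Longrightarrow> cocycle_char f g x = cocycle_char h (\<lambda>x y. 0) x"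
proof -
  obtain t where t: "t 0 = 0" "g = (\<lambda>x y. t x + t y - t (x + y))"
    using symmetric_cocycle_trivial[OF assms] .
  define u where "u x = - t x" for x
  have u: "u 0 = 0" by (simp add: u_def t)
  let ?f = "\<lambda>x y. f x y + - u (bracket x y)" and ?g = "\<lambda>x y. g x y + (u x + u y - u (x + y))"
  have g: "?g = (\<lambda>x y. 0)"
    by (simp add: t(2) u_def)
  show thesis
  proof
    show "lie_cocycle ?f (\<lambda>x y. 0)"
      using lie_cocycle_add[OF assms coboundary_cocycle[of u, OF u]] unfolding g .
    show "cocycle_char f g x = cocycle_char ?f (\<lambda>x y. 0) x" if "x \<in> res_cycles" for x
      using fun_cong[OF cocycle_char_add[OF assms coboundary_cocycle[of u, OF u]], of x]
        cocycle_char_coboundary_res_cycles[of u, OF u that] unfolding g by simp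
  qed
qed

section \<open>Characters of the Schur multiplier\<close>

definition cycle_group :: "'l::lie_ring res1 abelianization monoid" where
  "cycle_group = add_group\<lparr>carrier := res_cycles\<rparr>"

lemma cycle_group_simps [simp]:
  "carrier cycle_group = res_cycles" "x \<otimes>\<^bsub>cycle_group\<^esub> y = x + y" "\<one>\<^bsub>cycle_group\<^esub> = 0"
  by (simp_all add: cycle_group_def)

lemma comm_group_cycle_group: "comm_group cycle_group"
proof -
  interpret comm_group "add_group :: 'a res1 abelianization monoid" by (rule comm_group_add_group)
  show ?thesis
    unfolding cycle_group_def
    by (intro subgroup_comm_group subgroupI) (use res_cycles_closed in auto)
qed

lemma inv_cycle_group:
  assumes "x \<in> res_cycles"
  shows "inv\<^bsub>cycle_group\<^esub> x = - x"
proof -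
  interpret comm_group "cycle_group :: 'a res1 abelianization monoid" by (rule comm_group_cycle_group)
  show ?thesis by (rule inv_equality) (use assms res_cycles_closed(3) in simp_all)
qed

lemma subgroup_res_boundaries: "subgroup res_boundaries (cycle_group :: 'l::lie_ring res1 abelianization monoid)"
proof -
  interpret comm_group "cycle_group :: 'l res1 abelianization monoid" by (rule comm_group_cycle_group)
  note add = additive.add[OF additive_ab_face2] additive.zero[OF additive_ab_face2]
    additive.minus[OF additive_ab_face2]
  show ?thesis
  proof (rule subgroupI)
    show "res_boundaries \<subseteq> carrier (cycle_group :: 'l res1 abelianization monoid)"
      using res_boundaries_subset_cycles by simp
    have "0 \<in> (res_boundaries :: 'l res1 abelianization set)"
      unfolding res_boundaries_def using add(2) by force
    then show "(res_boundaries :: 'l res1 abelianization set) \<noteq> {}" by blast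
    fix a :: "'l res1 abelianization" assume a: "a \<in> res_boundaries"
    then obtain x :: "'l res2 abelianization" where x: "a = ab_map (res_face2 (Suc (Suc 0))) x"
      "ab_map (res_face2 0) x = 0" "ab_map (res_face2 (Suc 0)) x = 0"
      by (auto simp: res_boundaries_def)
    then have "- a \<in> res_boundaries"
      by (auto simp: res_boundaries_def add intro!: exI[of _ "- x"])
    then show "inv\<^bsub>cycle_group\<^esub> a \<in> res_boundaries"
      using a res_boundaries_subset_cycles by (auto simp: inv_cycle_group subset_iff)
    fix b :: "'l res1 abelianization" assume "b \<in> res_boundaries"
    then obtain y :: "'l res2 abelianization" where "b = ab_map (res_face2 (Suc (Suc 0))) y"
      "ab_map (res_face2 0) y = 0" "ab_map (res_face2 (Suc 0)) y = 0"
      by (auto simp: res_boundaries_def)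
    with x show "a \<otimes>\<^bsub>cycle_group\<^esub> b \<in> res_boundaries"
      by (auto simp: res_boundaries_def add intro!: exI[of _ "x + y"])
  qed
qed

lemma schur_multiplier_eq: "schur_multiplier TYPE('l::lie_ring) = cycle_group Mod res_boundaries"
proof -
  have all_le_1: "(\<forall>i\<le>1. P i) \<longleftrightarrow> P 0 \<and> P (Suc 0)" for P :: "nat \<Rightarrow> bool"
    by (auto simp: le_Suc_eq)
  have "\<lparr>carrier = res_cycles, monoid.mult = (+), one = 0\<rparr> = (cycle_group :: 'l res1 abelianization monoid)"
    by (simp add: cycle_group_def add_group_def)
  then show ?thesis
    unfolding schur_multiplier_def simplicial_pi_def all_le_1 res_cycles_def[symmetric]
    by (simp add: res_boundaries_def)
qed

lemma comm_group_schur_multiplier: "comm_group (schur_multiplier TYPE('l::lie_ring))"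
  unfolding schur_multiplier_eq
  by (rule comm_group.abelian_FactGroup[OF comm_group_cycle_group subgroup_res_boundaries])

definition cycle_class :: "'l::lie_ring res1 abelianization \<Rightarrow> 'l res1 abelianization set" where
  "cycle_class x = res_boundaries #>\<^bsub>cycle_group\<^esub> x"

lemma carrier_schur_multiplier: "carrier (schur_multiplier TYPE('l::lie_ring)) = cycle_class ` res_cycles"
  unfolding schur_multiplier_eq carrier_FactGroup cycle_class_def by simp

lemma mult_schur_multiplier:
  assumes "x \<in> res_cycles" "y \<in> res_cycles"
  shows "cycle_class x \<otimes>\<^bsub>schur_multiplier TYPE('l::lie_ring)\<^esub> cycle_class y = cycle_class (x + y)"
proof -
  interpret comm_group "cycle_group :: 'l res1 abelianization monoid" by (rule comm_group_cycle_group)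
  interpret normal res_boundaries "cycle_group :: 'l res1 abelianization monoid"
    using subgroup_res_boundaries by (simp add: normal_iff_subgroup)
  show ?thesis
    unfolding schur_multiplier_eq cycle_class_def using rcos_sum[of x y] assms by simp
qed

lemma one_schur_multiplier: "\<one>\<^bsub>schur_multiplier TYPE('l::lie_ring)\<^esub> = cycle_class 0"
  unfolding schur_multiplier_eq cycle_class_def by (simp add: r_coset_def)

lemma cycle_class_res_boundaries:
  assumes "x \<in> res_boundaries"
  shows "cycle_class x = cycle_class 0"
proof -
  interpret comm_group "cycle_group :: 'a res1 abelianization monoid" by (rule comm_group_cycle_group)
  show ?thesis
    using coset_join2[OF _ subgroup_res_boundaries assms] assms res_boundaries_subset_cycles
    by (auto simp: cycle_class_def r_coset_def)
qed

section \<open>Characters of the multiplier induced by cocycles\<close>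

definition schur_char ::
  "('l::lie_ring \<Rightarrow> 'l \<Rightarrow> cunit) \<Rightarrow> ('l \<Rightarrow> 'l \<Rightarrow> cunit) \<Rightarrow> 'l res1 abelianization set \<Rightarrow> complex" where
  "schur_char f g X = complex_of_cunit (cocycle_char f g (SOME x. x \<in> X))"

text \<open>A coset is nonempty and its elements differ by boundaries, on which the character is
  zero, so the choice in \<open>schur_char\<close> is harmless.\<close>

lemma schur_char_cycle_class:
  assumes "lie_cocycle f g" "x \<in> res_cycles"
  shows "schur_char f g (cycle_class x) = complex_of_cunit (cocycle_char f g x)"
proof -
  have "b + x \<in> cycle_class x" if "b \<in> res_boundaries" for b
    using that by (auto simp: cycle_class_def r_coset_def)
  then have "\<exists>y. y \<in> cycle_class x"
    using subgroup.one_closed[OF subgroup_res_boundaries] by auto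
  then have "(SOME y. y \<in> cycle_class x) \<in> cycle_class x"
    by (rule someI_ex)
  then obtain b where b: "b \<in> res_boundaries" "(SOME y. y \<in> cycle_class x) = b + x"
    by (auto simp: cycle_class_def r_coset_def)
  then show ?thesis
    by (simp add: schur_char_def additive.add[OF additive_cocycle_char] cocycle_char_res_boundaries[OF assms(1)])
qed

lemma schur_char_hom:
  assumes "lie_cocycle (f :: 'l::lie_ring \<Rightarrow> 'l \<Rightarrow> cunit) g"
  shows "schur_char f g \<in> hom (schur_multiplier TYPE('l)) complex_units"
proof (rule homI)
  fix X Y assume "X \<in> carrier (schur_multiplier TYPE('l))" "Y \<in> carrier (schur_multiplier TYPE('l))"
  then obtain x y where "X = cycle_class x" "x \<in> res_cycles" "Y = cycle_class y" "y \<in> res_cycles"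
    by (auto simp: carrier_schur_multiplier)
  then show "schur_char f g (X \<otimes>\<^bsub>schur_multiplier TYPE('l)\<^esub> Y) = schur_char f g X \<otimes>\<^bsub>complex_units\<^esub> schur_char f g Y"
    by (simp add: mult_schur_multiplier schur_char_cycle_class[OF assms] res_cycles_closed(2)
        additive.add[OF additive_cocycle_char] plus_cunit.rep_eq)
qed (simp add: schur_char_def)

lemma schur_char_add:
  assumes "lie_cocycle f g" "lie_cocycle f' g'" "X \<in> carrier (schur_multiplier TYPE('l::lie_ring))"
  shows "schur_char (\<lambda>x y. f x y + f' x y) (\<lambda>x y. g x y + g' x y) X = schur_char f g X * schur_char f' g' X"
proof -
  obtain x where "X = cycle_class x" "x \<in> res_cycles"
    using assms(3) by (auto simp: carrier_schur_multiplier)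
  then show ?thesis
    using assms by (simp add: schur_char_cycle_class lie_cocycle_add cocycle_char_add plus_cunit.rep_eq)
qed

text \<open>Pulled back along \<open>cycle_class\<close>, \<open>\<chi>\<close> is trivial on
  boundaries, and \<open>cocycle_char_surj\<close> applies.\<close>

lemma schur_char_surj:
  assumes "\<chi> \<in> hom (schur_multiplier TYPE('l::lie_ring)) complex_units"
  shows "\<exists>f g :: 'l \<Rightarrow> 'l \<Rightarrow> cunit. lie_cocycle f g \<and>
    (\<forall>X\<in>carrier (schur_multiplier TYPE('l)). \<chi> X = schur_char f g X)"
proof -
  interpret M: comm_group "schur_multiplier TYPE('l)" by (rule comm_group_schur_multiplier)
  note hom = hom_complex_unitsD[OF M.is_group assms]
  have carr: "cycle_class x \<in> carrier (schur_multiplier TYPE('l))" if "x \<in> res_cycles" for x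
    using that by (simp add: carrier_schur_multiplier)
  define \<Psi> where "\<Psi> x = cunit_of_complex (\<chi> (cycle_class x))" for x
  have "\<Psi> (x + y) = \<Psi> x + \<Psi> y" if "x \<in> res_cycles" "y \<in> res_cycles" for x y
    using that hom(1)[OF carr[OF that(1)]] hom(1)[OF carr[OF that(2)]]
      hom(2)[OF carr[OF that(1)] carr[OF that(2)]]
    by (simp add: \<Psi>_def mult_schur_multiplier cunit_of_complex_hom)
  moreover have "\<Psi> x = 0" if "x \<in> res_boundaries" for x
    using hom(3) unfolding \<Psi>_def cycle_class_res_boundaries[OF that]
    by (simp add: one_schur_multiplier cunit_of_complex_hom)
  ultimately obtain f g where fg: "lie_cocycle f g" "\<And>x. x \<in> res_cycles \<Longrightarrow> \<Psi> x = cocycle_char f g x"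
    using cocycle_char_surj[of \<Psi>] by blast
  show ?thesis
  proof (intro exI conjI ballI)
    show "lie_cocycle f g" by fact
    fix X assume "X \<in> carrier (schur_multiplier TYPE('l))"
    then obtain x where x: "X = cycle_class x" "x \<in> res_cycles"
      by (auto simp: carrier_schur_multiplier)
    show "\<chi> X = schur_char f g X"
      using fg(2)[OF x(2)] hom(1)[OF carr[OF x(2)]] x
      by (simp add: schur_char_cycle_class[OF fg(1)] \<Psi>_def flip: fg(2))
  qed
qed

lemma schur_char_trivial_iff:
  assumes "lie_cocycle (f :: 'l::lie_ring \<Rightarrow> 'l \<Rightarrow> cunit) g"
  shows "(\<forall>X\<in>carrier (schur_multiplier TYPE('l)). schur_char f g X = 1) \<longleftrightarrow>
    (\<exists>t. t 0 = 0 \<and> f = (\<lambda>x y. - t (bracket x y)) \<and> g = (\<lambda>x y. t x + t y - t (x + y)))"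
proof -
  have "(\<forall>X\<in>carrier (schur_multiplier TYPE('l)). schur_char f g X = 1) \<longleftrightarrow>
      (\<forall>x\<in>res_cycles. cocycle_char f g x = 0)"
    by (simp add: carrier_schur_multiplier schur_char_cycle_class[OF assms])
  also have "\<dots> \<longleftrightarrow> (\<exists>t. t 0 = 0 \<and> f = (\<lambda>x y. - t (bracket x y)) \<and> g = (\<lambda>x y. t x + t y - t (x + y)))"
  proof
    assume "\<forall>x\<in>res_cycles. cocycle_char f g x = 0"
    then show "\<exists>t. t 0 = 0 \<and> f = (\<lambda>x y. - t (bracket x y)) \<and> g = (\<lambda>x y. t x + t y - t (x + y))"
      by (intro cocycle_char_eq_zero_imp_coboundary[OF assms]) simp
  next
    assume "\<exists>t. t 0 = 0 \<and> f = (\<lambda>x y. - t (bracket x y)) \<and> g = (\<lambda>x y. t x + t y - t (x + y))"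
    then obtain t where t: "t 0 = 0" and fg: "f = (\<lambda>x y. - t (bracket x y))" "g = (\<lambda>x y. t x + t y - t (x + y))"
      by (elim exE conjE)
    show "\<forall>x\<in>res_cycles. cocycle_char f g x = 0"
      unfolding fg using cocycle_char_coboundary_res_cycles[of t, OF t] by blast
  qed
  finally show ?thesis .
qed

lemma finite_schur_multiplier: "finite (carrier (schur_multiplier TYPE('l::{lie_ring, finite})))"
proof -
  interpret M: comm_group "schur_multiplier TYPE('l)" by (rule comm_group_schur_multiplier)
  interpret L: comm_group "add_group :: 'l monoid" by (rule comm_group_add_group)
  \<comment> \<open>All functions into the roots of unity of order dividing the cardinality of
    \<open>L\<close>, cocycles or not; this set only has to be finite and to contain every
    biadditive \<open>h\<close> obtained below.\<close>
  define H :: "('l \<Rightarrow> 'l \<Rightarrow> cunit) set" where "H = {h. \<forall>x y. complex_of_cunit (h x y) ^ card (UNIV :: 'l set) = 1}"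
  have "finite {a. complex_of_cunit a ^ card (UNIV :: 'l set) = 1}"
  proof (rule finite_imageD)
    show "finite (complex_of_cunit ` {a. complex_of_cunit a ^ card (UNIV :: 'l set) = 1})"
      by (rule finite_subset[OF _ finite_nth_roots[of "card (UNIV :: 'l set)" 1]]) (auto simp: card_gt_0_iff)
  qed (auto simp: inj_on_def complex_of_cunit_inject)
  then have "finite ((UNIV :: 'l set) \<rightarrow>\<^sub>E ((UNIV :: 'l set) \<rightarrow>\<^sub>E {a. complex_of_cunit a ^ card (UNIV :: 'l set) = 1}))"
    by (intro finite_PiE) auto
  then have H: "finite H"
    by (simp add: PiE_UNIV_domain Pi_def H_def)
  show ?thesis
  proof (rule M.finite_if_finitely_many_characters)
    show "finite ((\<lambda>h. schur_char h (\<lambda>x y. 0)) ` H)"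
      using H by simp
    fix \<chi> assume "\<chi> \<in> hom (schur_multiplier TYPE('l)) complex_units"
    then obtain f g :: "'l \<Rightarrow> 'l \<Rightarrow> cunit" where fg: "lie_cocycle f g"
      "\<forall>X\<in>carrier (schur_multiplier TYPE('l)). \<chi> X = schur_char f g X"
      using schur_char_surj by blast
    obtain h where h: "lie_cocycle h (\<lambda>x y. 0)"
      "\<And>x. x \<in> res_cycles \<Longrightarrow> cocycle_char f g x = cocycle_char h (\<lambda>x y. 0) x"
      using cocycle_char_biadditive[OF fg(1)] by blast
    have h_add: "h (x + y) z = h x z + h y z" for x y z
      using lie_cocycle.f_add_left[OF h(1), of x y z] by simp
    have "complex_of_cunit (h x y) ^ card (UNIV :: 'l set) = 1" for x y
    proof -
      have "(\<lambda>x. complex_of_cunit (h x y)) \<in> hom add_group complex_units"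
        by (rule homI) (simp_all add: h_add plus_cunit.rep_eq)
      note hom = hom_complex_unitsD[OF L.is_group this]
      \<comment> \<open>Lagrange's theorem in the additive group of \<open>L\<close>; the
        homomorphism \<open>h\<close> with second argument fixed carries it to the values.\<close>
      have "x [^]\<^bsub>add_group\<^esub> int (card (UNIV :: 'l set)) = \<one>\<^bsub>add_group\<^esub>"
        using L.pow_order_eq_1[of x] unfolding int_pow_int order_def by simp
      then show ?thesis
        using hom(3) hom(4)[of x "int (card (UNIV :: 'l set))"] by (simp add: zero_cunit.rep_eq)
    qed
    then have "h \<in> H" by (simp add: H_def)
    moreover have "\<forall>X\<in>carrier (schur_multiplier TYPE('l)). \<chi> X = schur_char h (\<lambda>x y. 0) X"
      using fg(2)
      by (auto simp: carrier_schur_multiplier schur_char_cycle_class[OF fg(1)] schur_char_cycle_class[OF h(1)] h(2))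
    ultimately show "\<exists>\<xi>\<in>(\<lambda>h. schur_char h (\<lambda>x y. 0)) ` H. \<forall>X\<in>carrier (schur_multiplier TYPE('l)). \<chi> X = \<xi> X"
      by blast
  qed
qed

section \<open>Cocycles with values in the multiplicative group\<close>

definition cunit_fun :: "('l \<Rightarrow> 'l \<Rightarrow> complex) \<Rightarrow> 'l \<Rightarrow> 'l \<Rightarrow> cunit" where
  "cunit_fun f x y = cunit_of_complex (f x y)"

definition complex_fun :: "('l \<Rightarrow> 'l \<Rightarrow> cunit) \<Rightarrow> 'l \<Rightarrow> 'l \<Rightarrow> complex" where
  "complex_fun f x y = complex_of_cunit (f x y)"

lemma cunit_fun_complex_fun [simp]: "cunit_fun (complex_fun f) = f"
  by (intro ext) (simp add: cunit_fun_def complex_fun_def complex_of_cunit_inverse)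

lemma complex_fun_in_lie_Z2_iff:
  "(complex_fun f, complex_fun g) \<in> carrier (lie_Z2 TYPE('l::lie_ring) complex_units) \<longleftrightarrow> lie_cocycle f g"
proof -
  have transfer: "complex_of_cunit a * complex_of_cunit b = complex_of_cunit (a + b)"
    "inverse (complex_of_cunit a) = complex_of_cunit (- a)"
    "complex_of_cunit a = complex_of_cunit b \<longleftrightarrow> a = b" for a b
    by (simp_all add: plus_cunit.rep_eq uminus_cunit.rep_eq complex_of_cunit_inject)
  show ?thesis
    by (simp add: lie_Z2_def lie_cocycle_def complex_fun_def all_conj_distrib transfer)
qed

text \<open>Cocycle values are nonzero, so each cocycle comes from functions into
  \<open>cunit\<close>.\<close>

lemma lie_Z2_cases:
  assumes "p \<in> carrier (lie_Z2 TYPE('l::lie_ring) complex_units)"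
  obtains f g :: "'l::lie_ring \<Rightarrow> 'l \<Rightarrow> cunit" where "p = (complex_fun f, complex_fun g)" "lie_cocycle f g"
proof -
  obtain f g where p: "p = (f, g)" by (cases p)
  then have "f x y \<noteq> 0" "g x y \<noteq> 0" for x y
    using assms by (auto simp: lie_Z2_def)
  then have "p = (complex_fun (cunit_fun f), complex_fun (cunit_fun g))"
    by (simp add: p complex_fun_def cunit_fun_def fun_eq_iff)
  with assms that show thesis
    using complex_fun_in_lie_Z2_iff by metis
qed

lemma mult_lie_Z2:
  "(complex_fun f, complex_fun g) \<otimes>\<^bsub>lie_Z2 TYPE('l::lie_ring) complex_units\<^esub> (complex_fun f', complex_fun g') =
    (complex_fun (\<lambda>x y. f x y + f' x y), complex_fun (\<lambda>x y. g x y + g' x y))"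
  by (simp add: lie_Z2_def complex_fun_def plus_cunit.rep_eq fun_eq_iff)

lemma one_lie_Z2: "\<one>\<^bsub>lie_Z2 TYPE('l::lie_ring) complex_units\<^esub> = (complex_fun (\<lambda>x y. 0), complex_fun (\<lambda>x y. 0))"
  by (simp add: lie_Z2_def complex_fun_def zero_cunit.rep_eq fun_eq_iff)

lemma group_lie_Z2: "group (lie_Z2 TYPE('l::lie_ring) complex_units)"
proof (rule groupI)
  let ?Z = "lie_Z2 TYPE('l) complex_units"
  show "\<one>\<^bsub>?Z\<^esub> \<in> carrier ?Z"
    by (simp add: one_lie_Z2 complex_fun_in_lie_Z2_iff lie_cocycle_zero)
  fix p assume "p \<in> carrier ?Z"
  then obtain f g :: "'l \<Rightarrow> 'l \<Rightarrow> cunit" where p: "p = (complex_fun f, complex_fun g)" "lie_cocycle f g"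
    by (rule lie_Z2_cases)
  show "\<one>\<^bsub>?Z\<^esub> \<otimes>\<^bsub>?Z\<^esub> p = p"
    by (simp add: p one_lie_Z2 mult_lie_Z2)
  show "\<exists>q\<in>carrier ?Z. q \<otimes>\<^bsub>?Z\<^esub> p = \<one>\<^bsub>?Z\<^esub>"
    using lie_cocycle_uminus[OF p(2)]
    by (intro bexI[of _ "(complex_fun (\<lambda>x y. - f x y), complex_fun (\<lambda>x y. - g x y))"])
      (simp_all add: p one_lie_Z2 mult_lie_Z2 complex_fun_in_lie_Z2_iff)
  fix q assume "q \<in> carrier ?Z"
  then obtain f' g' :: "'l \<Rightarrow> 'l \<Rightarrow> cunit" where q: "q = (complex_fun f', complex_fun g')" "lie_cocycle f' g'"
    by (rule lie_Z2_cases)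
  show "p \<otimes>\<^bsub>?Z\<^esub> q \<in> carrier ?Z"
    using p q by (simp add: mult_lie_Z2 complex_fun_in_lie_Z2_iff lie_cocycle_add)
  fix r assume "r \<in> carrier ?Z"
  then obtain f'' g'' :: "'l \<Rightarrow> 'l \<Rightarrow> cunit" where r: "r = (complex_fun f'', complex_fun g'')" "lie_cocycle f'' g''"
    by (rule lie_Z2_cases)
  show "p \<otimes>\<^bsub>?Z\<^esub> q \<otimes>\<^bsub>?Z\<^esub> r = p \<otimes>\<^bsub>?Z\<^esub> (q \<otimes>\<^bsub>?Z\<^esub> r)"
    by (simp add: p q r mult_lie_Z2 add.assoc)
qed

lemma complex_fun_in_lie_B2_iff:
  "(complex_fun f, complex_fun g) \<in> lie_B2 TYPE('l::lie_ring) complex_units \<longleftrightarrow>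
    (\<exists>t. t 0 = 0 \<and> f = (\<lambda>x y. - t (bracket x y)) \<and> g = (\<lambda>x y. t x + t y - t (x + y)))"
proof
  assume "(complex_fun f, complex_fun g) \<in> lie_B2 TYPE('l) complex_units"
  then obtain t where B: "complex_fun f = (\<lambda>x y. inv\<^bsub>complex_units\<^esub> (t (bracket x y)))"
    "complex_fun g = (\<lambda>x y. t x \<otimes>\<^bsub>complex_units\<^esub> t y \<otimes>\<^bsub>complex_units\<^esub> inv\<^bsub>complex_units\<^esub> (t (x + y)))"
    "\<forall>x. t x \<in> carrier complex_units" "t 0 = \<one>\<^bsub>complex_units\<^esub>"
    unfolding lie_B2_def by blast
  then have t: "\<And>x. t x \<noteq> 0" "t 0 = 1"
    "complex_fun f = (\<lambda>x y. inverse (t (bracket x y)))" "complex_fun g = (\<lambda>x y. t x * t y * inverse (t (x + y)))"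
    by simp_all
  have "f = cunit_fun (complex_fun f)" "g = cunit_fun (complex_fun g)"
    by simp_all
  then have "f = (\<lambda>x y. - cunit_of_complex (t (bracket x y)))"
    "g = (\<lambda>x y. cunit_of_complex (t x) + cunit_of_complex (t y) - cunit_of_complex (t (x + y)))"
    unfolding t(3,4) by (simp_all add: cunit_fun_def fun_eq_iff t(1) cunit_of_complex_hom)
  then show "\<exists>t. t 0 = 0 \<and> f = (\<lambda>x y. - t (bracket x y)) \<and> g = (\<lambda>x y. t x + t y - t (x + y))"
    using t(2) by (intro exI[of _ "\<lambda>x. cunit_of_complex (t x)"]) (simp add: cunit_of_complex_hom)
next
  assume "\<exists>t. t 0 = 0 \<and> f = (\<lambda>x y. - t (bracket x y)) \<and> g = (\<lambda>x y. t x + t y - t (x + y))"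
  then obtain t where "t 0 = 0" "f = (\<lambda>x y. - t (bracket x y))" "g = (\<lambda>x y. t x + t y - t (x + y))"
    by blast
  then show "(complex_fun f, complex_fun g) \<in> lie_B2 TYPE('l) complex_units"
    unfolding lie_B2_def
    by (intro CollectI exI[of _ "\<lambda>x. complex_of_cunit (t x)"])
      (simp add: complex_fun_def fun_eq_iff zero_cunit.rep_eq plus_cunit.rep_eq uminus_cunit.rep_eq
        minus_cunit.rep_eq divide_inverse)
qed

lemma lie_B2_subset_lie_Z2: "lie_B2 TYPE('l::lie_ring) complex_units \<subseteq> carrier (lie_Z2 TYPE('l) complex_units)"
proof
  fix p assume p: "p \<in> lie_B2 TYPE('l) complex_units"
  then obtain f g where fg: "p = (f, g)" "\<And>x y. f x y \<noteq> 0 \<and> g x y \<noteq> 0"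
    by (auto simp: lie_B2_def)
  then have "p = (complex_fun (cunit_fun f), complex_fun (cunit_fun g))"
    by (simp add: complex_fun_def cunit_fun_def fun_eq_iff)
  with p show "p \<in> carrier (lie_Z2 TYPE('l) complex_units)"
    by (auto simp: complex_fun_in_lie_B2_iff complex_fun_in_lie_Z2_iff coboundary_cocycle)
qed

section \<open>Comparison of the multiplier with the cohomology group by duality\<close>

theorem corollary1p3:
  shows "schur_multiplier TYPE('a::{lie_ring, finite}) \<cong> lie_H2 TYPE('a) complex_units"
proof -
  let ?M = "schur_multiplier TYPE('a)" and ?Z = "lie_Z2 TYPE('a) complex_units"
  interpret M: comm_group ?M by (rule comm_group_schur_multiplier)
  interpret Z: group ?Z by (rule group_lie_Z2)
  \<comment> \<open>Finiteness of the multiplier provides a self-pairing; the isomorphism depends on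
    its choice.\<close>
  obtain \<beta> where \<beta>: "perfect_pairing ?M \<beta>"
    using perfect_pairing_exists[OF M.comm_group_axioms finite_schur_multiplier] by blast
  have \<beta>_hom: "\<beta> m \<in> hom ?M complex_units" if "m \<in> carrier ?M" for m
    using \<beta> that by (simp add: perfect_pairing_def)
  have \<beta>_mult: "\<beta> (m \<otimes>\<^bsub>?M\<^esub> m') X = \<beta> m X * \<beta> m' X"
    if "m \<in> carrier ?M" "m' \<in> carrier ?M" "X \<in> carrier ?M" for m m' X
    using \<beta> that by (simp add: perfect_pairing_def)
  have \<beta>_one: "\<beta> \<one>\<^bsub>?M\<^esub> X = 1" if "X \<in> carrier ?M" for X
    using \<beta>_mult[of "\<one>\<^bsub>?M\<^esub>" "\<one>\<^bsub>?M\<^esub>" X] that hom_complex_unitsD(1)[OF M.is_group \<beta>_hom[OF M.one_closed]] by simp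
  have \<beta>_inj: "m = m'"
    if m: "m \<in> carrier ?M" "m' \<in> carrier ?M" and eq: "\<And>X. X \<in> carrier ?M \<Longrightarrow> \<beta> m X = \<beta> m' X" for m m'
  proof -
    have "\<beta> (m \<otimes>\<^bsub>?M\<^esub> inv\<^bsub>?M\<^esub> m') X = 1" if X: "X \<in> carrier ?M" for X
      using \<beta>_mult[of m "inv\<^bsub>?M\<^esub> m'" X] \<beta>_mult[of m' "inv\<^bsub>?M\<^esub> m'" X] \<beta>_one[OF X] eq[OF X] m X by simp
    then have "m \<otimes>\<^bsub>?M\<^esub> inv\<^bsub>?M\<^esub> m' = \<one>\<^bsub>?M\<^esub>"
      using \<beta> m by (simp add: perfect_pairing_def)
    then show ?thesis
      using m by (metis M.inv_equality M.inv_closed M.inv_inv)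
  qed
  have \<beta>_surj: "\<exists>m\<in>carrier ?M. \<forall>X\<in>carrier ?M. \<chi> X = \<beta> m X" if "\<chi> \<in> hom ?M complex_units" for \<chi>
    using \<beta> that by (simp add: perfect_pairing_def)
  \<comment> \<open>\<open>\<kappa>\<close> sends a cocycle to the element of the multiplier that
    represents its character under \<open>\<beta>\<close>. It exists by \<open>\<beta>_surj\<close>
    and is unique by \<open>\<beta>_inj\<close>.\<close>
  define \<kappa> where "\<kappa> p = (SOME m. m \<in> carrier ?M \<and>
    (\<forall>X\<in>carrier ?M. schur_char (cunit_fun (fst p)) (cunit_fun (snd p)) X = \<beta> m X))" for p
  have \<kappa>: "\<kappa> (complex_fun f, complex_fun g) \<in> carrier ?M"
    "\<And>X. X \<in> carrier ?M \<Longrightarrow> \<beta> (\<kappa> (complex_fun f, complex_fun g)) X = schur_char f g X"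
    if "lie_cocycle f g" for f g
  proof -
    have "\<exists>m. m \<in> carrier ?M \<and> (\<forall>X\<in>carrier ?M. schur_char f g X = \<beta> m X)"
      using \<beta>_surj[OF schur_char_hom[OF that]] by blast
    then have "\<kappa> (complex_fun f, complex_fun g) \<in> carrier ?M \<and>
        (\<forall>X\<in>carrier ?M. schur_char f g X = \<beta> (\<kappa> (complex_fun f, complex_fun g)) X)"
      unfolding \<kappa>_def fst_conv snd_conv cunit_fun_complex_fun by (rule someI_ex)
    then show "\<kappa> (complex_fun f, complex_fun g) \<in> carrier ?M"
      "\<And>X. X \<in> carrier ?M \<Longrightarrow> \<beta> (\<kappa> (complex_fun f, complex_fun g)) X = schur_char f g X"
      by auto
  qed
  have \<kappa>_eqI: "\<kappa> (complex_fun f, complex_fun g) = m"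
    if "lie_cocycle f g" "m \<in> carrier ?M" "\<And>X. X \<in> carrier ?M \<Longrightarrow> schur_char f g X = \<beta> m X" for f g m
    using that \<kappa>[OF that(1)] by (intro \<beta>_inj) simp_all
  interpret \<kappa>: group_hom ?Z ?M \<kappa>
  proof unfold_locales
    show "\<kappa> \<in> hom ?Z ?M"
    proof (rule homI)
      fix p assume "p \<in> carrier ?Z"
      then obtain f g :: "'a \<Rightarrow> 'a \<Rightarrow> cunit" where p: "p = (complex_fun f, complex_fun g)" "lie_cocycle f g"
        by (rule lie_Z2_cases)
      show "\<kappa> p \<in> carrier ?M"
        using p \<kappa>(1) by simp
      fix q assume "q \<in> carrier ?Z"
      then obtain f' g' :: "'a \<Rightarrow> 'a \<Rightarrow> cunit" where q: "q = (complex_fun f', complex_fun g')" "lie_cocycle f' g'"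
        by (rule lie_Z2_cases)
      show "\<kappa> (p \<otimes>\<^bsub>?Z\<^esub> q) = \<kappa> p \<otimes>\<^bsub>?M\<^esub> \<kappa> q"
        unfolding p(1) q(1) mult_lie_Z2
        using \<kappa>[OF p(2)] \<kappa>[OF q(2)]
        by (intro \<kappa>_eqI lie_cocycle_add p q) (simp_all add: \<beta>_mult schur_char_add[OF p(2) q(2)])
    qed
  qed
  have "\<kappa> ` carrier ?Z = carrier ?M"
  proof
    show "carrier ?M \<subseteq> \<kappa> ` carrier ?Z"
    proof
      \<comment> \<open>\<open>\<beta> m\<close> is a character of the multiplier, hence the
        character of some cocycle.\<close>
      fix m assume m: "m \<in> carrier ?M"
      obtain f g :: "'a \<Rightarrow> 'a \<Rightarrow> cunit" where fg: "lie_cocycle f g" "\<forall>X\<in>carrier ?M. \<beta> m X = schur_char f g X"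
        using schur_char_surj[OF \<beta>_hom[OF m]] by blast
      then have "\<kappa> (complex_fun f, complex_fun g) = m"
        using m by (intro \<kappa>_eqI) simp_all
      then show "m \<in> \<kappa> ` carrier ?Z"
        using fg(1) complex_fun_in_lie_Z2_iff by blast
    qed
  qed auto
  moreover have ker: "kernel ?Z ?M \<kappa> = lie_B2 TYPE('a) complex_units"
  proof -
    have "\<kappa> p = \<one>\<^bsub>?M\<^esub> \<longleftrightarrow> p \<in> lie_B2 TYPE('a) complex_units" if "p \<in> carrier ?Z" for p
    proof -
      obtain f g :: "'a \<Rightarrow> 'a \<Rightarrow> cunit" where p: "p = (complex_fun f, complex_fun g)" "lie_cocycle f g"
        using \<open>p \<in> carrier ?Z\<close> by (rule lie_Z2_cases)
      \<comment> \<open>The unit is the element representing the trivial character, and cocycles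
        with trivial character are the coboundaries. The first isomorphism theorem then finishes the
        comparison.\<close>
      have "\<kappa> p = \<one>\<^bsub>?M\<^esub> \<longleftrightarrow> (\<forall>X\<in>carrier ?M. schur_char f g X = 1)"
        using \<kappa>_eqI[OF p(2) M.one_closed] \<kappa>(2)[OF p(2)] \<beta>_one p(1) by auto
      then show ?thesis
        unfolding p(1) complex_fun_in_lie_B2_iff schur_char_trivial_iff[OF p(2)] .
    qed
    then show ?thesis
      using lie_B2_subset_lie_Z2 by (auto simp: kernel_def)
  qed
  ultimately have "lie_H2 TYPE('a) complex_units \<cong> ?M"
    using \<kappa>.FactGroup_iso by (simp add: lie_H2_def)
  moreover have "group (lie_H2 TYPE('a) complex_units)"
    using normal.factorgroup_is_group[OF \<kappa>.normal_kernel] by (simp add: lie_H2_def ker)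
  ultimately show ?thesis
    by (rule group.iso_sym[rotated])
qed

end
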